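(* Let $(A,\mu,\alpha,\mathbf{1},\Delta,\beta,\epsilon,S)$ be an $(\alpha,\beta)$-Hom-Hopf algebra. Each of the following forms a Hom-group, with product $\mu$, inverse of $g$ given by $S(g)$, and unit $\mathbf{1}$: the group-like elements of $A$; the formal group-like elements of $A$; the $p$-order group-like elements, for an arbitrary $p\in\mathbb{N}$; and the formal group-like sequences of $A$.
   Context: $\mathbb{K}$ is a field, $\mathbb{N}=\{0,1,2,\dots\}$. Hom-group: a set $(G,\vee,\alpha,\mathbf{1})$ equipped with a Hom-associative product with unit $\mathbf 1$ (i.e. $\alpha(x\vee y)=\alpha(x)\vee\alpha(y)$, $\alpha(x)\vee(y\vee z)=(x\vee y)\vee\alpha(z)$, $x\vee\mathbf 1=\mathbf 1\vee x=\alpha(x)$, $\alpha(\mathbf 1)=\mathbf 1$) and an anti-morphism $g\mapsto g^{-1}$ such that for any $g\in G$ there is $k\in\mathbb{N}$ with $\alpha^k(g\vee g^{-1})=\alpha^k(g^{-1}\vee g)=\mathbf 1$. Hom-Hopf algebras. A unital Hom-associative algebra $(A,\mu,\alpha,\eta)$ is a vector space with a bilinear product $\mu$, a linear $\alpha$ with $\alpha(\mu(x,y))=\mu(\alpha(x),\alpha(y))$, $\mu(\alpha(x),\mu(y,z))=\mu(\mu(x,y),\alpha(z))$, and a linear $\eta:\mathbb{K}\to A$ with $\mathbf{1}=\eta(1)$, $\mu(x,\mathbf{1})=\mu(\mathbf{1},x)=\alpha(x)$, $\alpha(\mathbf{1})=\mathbf{1}$. A counital Hom-coassociative coalgebra $(A,\Delta,\beta,\epsilon)$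 consists of linear maps $\Delta:A\to A\otimes A$, $\beta:A\to A$, $\epsilon:A\to\mathbb{K}$ with $(\beta\otimes\Delta)\circ\Delta=(\Delta\otimes\beta)\circ\Delta$, $(\mathrm{id}\otimes\epsilon)\circ\Delta=\beta=(\epsilon\otimes\mathrm{id})\circ\Delta$, $\epsilon\circ\beta=\epsilon$. An $(\alpha,\beta)$-Hom-bialgebra is both, with $\Delta(\mu(x,y))=\Delta(x)\cdot\Delta(y)$ (componentwise product on $A\otimes A$), $\Delta(\mathbf{1})=\mathbf{1}\otimes\mathbf{1}$, $\epsilon(\mathbf{1})=1$, $\epsilon(\mu(x,y))=\epsilon(x)\epsilon(y)$, $\epsilon\circ\alpha=\epsilon$. Convolution: $f\star g=\mu\circ(f\otimes g)\circ\Delta$. An antipode is an anti-homomorphism $S$ of $A$ (linear, $S(\mu(x,y))=\mu(S(y),S(x))$) with $S\circ\alpha=\alpha\circ S$, $S\circ\eta=\eta$, $\epsilon\circ S=\epsilon$, such that for every $x\in A$ there is $k\in\mathbb{N}$ with $\alpha^k((S\star\mathrm{id})(x))=\alpha^k((\mathrm{id}\star S)(x))=\eta\circ\epsilon(x)$; the smallest such $k$ is the invertibility index of $x$. An $(\alpha,\beta)$-Hom-Hopf algebra is an $(\alpha,\beta)$-Hom-bialgebra with an antipode. Let $\nu$ be a formal parameter. All structural maps are extended $\mathbb{K}[[\nu]]$-linearly to formal series (with $\Delta:A[[\nu]]\to(A\otimes A)[[\nu]]$), and invertibility indexes of elements of $A[\nu]$ are defined by the same formula. $A_b[[\nu]]$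 is the space of formal series $\sum_{i\ge0}g_i\nu^i$, $g_i\in A$, such that the invertibility indexes of the $g_i$ are bounded. Group-like element: $g\in A$ with $\Delta(g)=g\otimes g$, $\epsilon(g)=1$. Formal group-like element: $g(\nu)\in A_b[[\nu]]$ with $\Delta(g(\nu))=g(\nu)\otimes g(\nu)$, $\epsilon(g(\nu))=1$. $p$-order group-like element: $g(\nu)\in A[\nu]$ with $\Delta(g(\nu))=g(\nu)\otimes g(\nu)$ modulo $\nu^{p+1}$ and $\epsilon(g(\nu))=1$; identities between these are understood modulo $\nu^{p+1}$. Formal group-like sequence: a sequence $(g_p(\nu))_{p\in\mathbb{N}}$ in $A[\nu]$ such that (a) for all $p\ge1$, $g_p(\nu)$ is a $p$-order group-like element; (b) $g_{p+1}(\nu)=\alpha(g_p(\nu))$ modulo $\nu^{p+1}$; (c) there is $k$ such that the invertibility index of $g_p(\nu)$ is at most $k$ for all $p$. Operations on sequences are termwise, the $p$-th term being considered modulo $\nu^{p+1}$.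
   Formalization: The antipode S is additionally assumed anti-comultiplicative, Δ∘S = (S⊗S)∘flip∘Δ; with S only an algebra anti-homomorphism the claim fails, since S(g) need not be group-like (e.g. α(x)=ε(x)1, μ(x,y)=ε(x)ε(y)1, S(g)=1+g−h). *)

theory Defs
  imports
    "HOL-Library.Poly_Mapping"
    "HOL-Computational_Algebra.Formal_Power_Series"
begin

section \<open>Hom-groups\<close>

text \<open>
  An anti-morphism respects all of the structure \<open>(\<or>, \<alpha>, \<one>)\<close>, hence the last three axioms.
\<close>

locale hom_group =
  fixes G :: "'g set" and mul :: "'g \<Rightarrow> 'g \<Rightarrow> 'g" (infixl "\<diamondop>" 70)
    and \<alpha> :: "'g \<Rightarrow> 'g" and one :: 'g and inv :: "'g \<Rightarrow> 'g"
  assumes one_closed: "one \<in> G"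
    and mul_closed: "\<lbrakk>x \<in> G; y \<in> G\<rbrakk> \<Longrightarrow> x \<diamondop> y \<in> G"
    and twist_closed: "x \<in> G \<Longrightarrow> \<alpha> x \<in> G"
    and inv_closed: "x \<in> G \<Longrightarrow> inv x \<in> G"
    and twist_mul: "\<lbrakk>x \<in> G; y \<in> G\<rbrakk> \<Longrightarrow> \<alpha> (x \<diamondop> y) = \<alpha> x \<diamondop> \<alpha> y"
    and hom_assoc: "\<lbrakk>x \<in> G; y \<in> G; z \<in> G\<rbrakk> \<Longrightarrow> \<alpha> x \<diamondop> (y \<diamondop> z) = (x \<diamondop> y) \<diamondop> \<alpha> z"
    and mul_one: "x \<in> G \<Longrightarrow> x \<diamondop> one = \<alpha> x"
    and one_mul: "x \<in> G \<Longrightarrow> one \<diamondop> x = \<alpha> x"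
    and twist_one: "\<alpha> one = one"
    and hom_inverse: "x \<in> G \<Longrightarrow>
      \<exists>k::nat. (\<alpha> ^^ k) (x \<diamondop> inv x) = one \<and> (\<alpha> ^^ k) (inv x \<diamondop> x) = one"
    and inv_mul: "\<lbrakk>x \<in> G; y \<in> G\<rbrakk> \<Longrightarrow> inv (x \<diamondop> y) = inv y \<diamondop> inv x"
    and inv_twist: "x \<in> G \<Longrightarrow> inv (\<alpha> x) = \<alpha> (inv x)"
    and inv_one: "inv one = one"

text \<open>
  Operations induced on a quotient \<open>G // R\<close>, in the style of \<open>HOL.Equiv_Relations\<close>. If an
  operation did not respect \<open>R\<close>, the union would not be an equivalence class; closure of
  \<open>G // R\<close> under the induced operation thus includes well-definedness.
\<close>

definition quot1 :: "('g \<times> 'g) set \<Rightarrow> ('g \<Rightarrow> 'g) \<Rightarrow> 'g set \<Rightarrow> 'g set" where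
  "quot1 R f X = (\<Union>x\<in>X. R `` {f x})"

definition quot2 :: "('g \<times> 'g) set \<Rightarrow> ('g \<Rightarrow> 'g \<Rightarrow> 'g) \<Rightarrow> 'g set \<Rightarrow> 'g set \<Rightarrow> 'g set" where
  "quot2 R f X Y = (\<Union>x\<in>X. \<Union>y\<in>Y. R `` {f x y})"


section \<open>Tensor products\<close>

text \<open>
  Tensor products over the field \<open>'k\<close> are quotients of free vector spaces \<open>'x \<Rightarrow>\<^sub>0 'k\<close> by the
  relations of multilinearity. As HOL has no types depending on the scalar multiplication of
  \<open>A\<close>, the quotient is kept as a setoid: a tensor is given by a representative in the
  free vector space, and equality of tensors is congruence modulo the relations.
\<close>

definition free_scale :: "'k::field \<Rightarrow> ('x \<Rightarrow>\<^sub>0 'k) \<Rightarrow> ('x \<Rightarrow>\<^sub>0 'k)" where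
  "free_scale c = Poly_Mapping.map ((*) c)"

definition gen :: "'x \<Rightarrow> ('x \<Rightarrow>\<^sub>0 'k::field)" where
  "gen x = Poly_Mapping.single x 1"

text \<open>Linear extension of a function from the basis \<open>'x\<close> to a space with scaling \<open>sc\<close>.\<close>

definition free_ext ::
    "('k::field \<Rightarrow> 'v \<Rightarrow> 'v::comm_monoid_add) \<Rightarrow> ('x \<Rightarrow> 'v) \<Rightarrow> ('x \<Rightarrow>\<^sub>0 'k) \<Rightarrow> 'v" where
  "free_ext sc h t = (\<Sum>x\<in>Poly_Mapping.keys t. sc (Poly_Mapping.lookup t x) (h x))"

text \<open>
  A slot is a map such as \<open>\<lambda>a. (a, b)\<close>, in which one tensor factor varies and the
  others are fixed; the generators are required to be linear in every slot.
\<close>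

definition tensor_relators ::
    "('k::field \<Rightarrow> 'a \<Rightarrow> 'a::ab_group_add) \<Rightarrow> ('a \<Rightarrow> 'x) set \<Rightarrow> ('x \<Rightarrow>\<^sub>0 'k) set" where
  "tensor_relators scale slots =
     {gen (s (a + b)) - gen (s a) - gen (s b) | s a b. s \<in> slots} \<union>
     {gen (s (scale c a)) - free_scale c (gen (s a)) | s c a. s \<in> slots}"

definition slots2 :: "('a \<Rightarrow> 'a \<times> 'a) set" where
  "slots2 = {(\<lambda>a. (a, b)) | b. True} \<union> {(\<lambda>b. (a, b)) | a. True}"

definition slots3 :: "('a \<Rightarrow> 'a \<times> 'a \<times> 'a) set" where
  "slots3 = {(\<lambda>a. (a, b, c)) | b c. True} \<union> {(\<lambda>b. (a, b, c)) | a c. True}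
     \<union> {(\<lambda>c. (a, b, c)) | a b. True}"

text \<open>Equality in \<open>A \<otimes> A\<close> and in \<open>A \<otimes> A \<otimes> A\<close>.\<close>

definition tensor_eq2 :: "('k::field \<Rightarrow> 'a \<Rightarrow> 'a::ab_group_add) \<Rightarrow>
    ('a \<times> 'a \<Rightarrow>\<^sub>0 'k) \<Rightarrow> ('a \<times> 'a \<Rightarrow>\<^sub>0 'k) \<Rightarrow> bool" where
  "tensor_eq2 scale t u \<longleftrightarrow> t - u \<in> module.span free_scale (tensor_relators scale slots2)"

definition tensor_eq3 :: "('k::field \<Rightarrow> 'a \<Rightarrow> 'a::ab_group_add) \<Rightarrow>
    ('a \<times> 'a \<times> 'a \<Rightarrow>\<^sub>0 'k) \<Rightarrow> ('a \<times> 'a \<times> 'a \<Rightarrow>\<^sub>0 'k) \<Rightarrow> bool" where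
  "tensor_eq3 scale t u \<longleftrightarrow> t - u \<in> module.span free_scale (tensor_relators scale slots3)"

definition tens :: "'a \<Rightarrow> 'a \<Rightarrow> ('a \<times> 'a \<Rightarrow>\<^sub>0 'k::field)" where
  "tens a b = gen (a, b)"

definition tensor_map ::
    "('a \<Rightarrow> 'a) \<Rightarrow> ('a \<Rightarrow> 'a) \<Rightarrow> ('a \<times> 'a \<Rightarrow>\<^sub>0 'k::field) \<Rightarrow> ('a \<times> 'a \<Rightarrow>\<^sub>0 'k)" where
  "tensor_map f g = free_ext free_scale (\<lambda>(a, b). tens (f a) (g b))"

definition tensor_flip :: "('a \<times> 'a \<Rightarrow>\<^sub>0 'k::field) \<Rightarrow> ('a \<times> 'a \<Rightarrow>\<^sub>0 'k)" where
  "tensor_flip = free_ext free_scale (\<lambda>(a, b). tens b a)"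

definition tensor_mul :: "('a \<Rightarrow> 'a \<Rightarrow> 'a) \<Rightarrow>
    ('a \<times> 'a \<Rightarrow>\<^sub>0 'k::field) \<Rightarrow> ('a \<times> 'a \<Rightarrow>\<^sub>0 'k) \<Rightarrow> ('a \<times> 'a \<Rightarrow>\<^sub>0 'k)" where
  "tensor_mul \<mu> t u = free_ext free_scale
     (\<lambda>(a, b). free_ext free_scale (\<lambda>(c, d). tens (\<mu> a c) (\<mu> b d)) u) t"

text \<open>The maps \<open>f \<otimes> \<Delta>\<close> and \<open>\<Delta> \<otimes> f\<close> from \<open>A \<otimes> A\<close> to \<open>A \<otimes> A \<otimes> A\<close>.\<close>

definition tensor_map_left :: "('a \<Rightarrow> 'a) \<Rightarrow> ('a \<Rightarrow> ('a \<times> 'a \<Rightarrow>\<^sub>0 'k::field)) \<Rightarrow>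
    ('a \<times> 'a \<Rightarrow>\<^sub>0 'k) \<Rightarrow> ('a \<times> 'a \<times> 'a \<Rightarrow>\<^sub>0 'k)" where
  "tensor_map_left f \<Delta> = free_ext free_scale
     (\<lambda>(a, b). free_ext free_scale (\<lambda>(c, d). gen (f a, c, d)) (\<Delta> b))"

definition tensor_map_right :: "('a \<Rightarrow> ('a \<times> 'a \<Rightarrow>\<^sub>0 'k::field)) \<Rightarrow> ('a \<Rightarrow> 'a) \<Rightarrow>
    ('a \<times> 'a \<Rightarrow>\<^sub>0 'k) \<Rightarrow> ('a \<times> 'a \<times> 'a \<Rightarrow>\<^sub>0 'k)" where
  "tensor_map_right \<Delta> f = free_ext free_scale
     (\<lambda>(a, b). free_ext free_scale (\<lambda>(c, d). gen (c, d, f b)) (\<Delta> a))"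


section \<open>Formal series with coefficients in a vector space\<close>

text \<open>
  \<open>A[[\<nu>]]\<close> is \<open>'a fps\<close> and \<open>A[\<nu>]\<close> is its subspace \<open>fps_polys\<close>. The \<open>\<bbbK>[[\<nu>]]\<close>-linear
  extension of a linear map acts coefficientwise, that of a bilinear map is the Cauchy product.
\<close>

definition fps_map :: "('a \<Rightarrow> 'b) \<Rightarrow> 'a fps \<Rightarrow> 'b fps" where
  "fps_map f g = Abs_fps (\<lambda>n. f (fps_nth g n))"

definition fps_bilin :: "('a \<Rightarrow> 'b \<Rightarrow> 'c::comm_monoid_add) \<Rightarrow> 'a fps \<Rightarrow> 'b fps \<Rightarrow> 'c fps" where
  "fps_bilin B g h = Abs_fps (\<lambda>n. \<Sum>i=0..n. B (fps_nth g i) (fps_nth h (n - i)))"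

definition fps_polys :: "'a::zero fps set" where
  "fps_polys = {g. finite {n. fps_nth g n \<noteq> 0}}"

text \<open>Congruence modulo \<open>\<nu>\<^sup>p\<^sup>+\<^sup>1\<close>.\<close>

definition fps_cong :: "nat \<Rightarrow> 'a fps \<Rightarrow> 'a fps \<Rightarrow> bool" where
  "fps_cong p g h \<longleftrightarrow> (\<forall>n\<le>p. fps_nth g n = fps_nth h n)"


section \<open>Hom-Hopf algebras\<close>

locale hom_algebra = vector_space scale
  for scale :: "'k::field \<Rightarrow> 'a::ab_group_add \<Rightarrow> 'a" +
  fixes \<mu> :: "'a \<Rightarrow> 'a \<Rightarrow> 'a" and \<alpha> :: "'a \<Rightarrow> 'a" and one :: 'a
  assumes mu_linear_left: "Vector_Spaces.linear scale scale (\<lambda>x. \<mu> x y)"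
    and mu_linear_right: "Vector_Spaces.linear scale scale (\<mu> x)"
    and alpha_linear: "Vector_Spaces.linear scale scale \<alpha>"
    and alpha_mu: "\<alpha> (\<mu> x y) = \<mu> (\<alpha> x) (\<alpha> y)"
    and hom_assoc: "\<mu> (\<alpha> x) (\<mu> y z) = \<mu> (\<mu> x y) (\<alpha> z)"
    and mu_one: "\<mu> x one = \<alpha> x"
    and one_mu: "\<mu> one x = \<alpha> x"
    and alpha_one: "\<alpha> one = one"
begin

definition \<eta> :: "'k \<Rightarrow> 'a" where
  "\<eta> c = scale c one"

end

text \<open>
  \<open>\<Delta> x\<close> is a representative of the coproduct of \<open>x\<close>; accordingly \<open>\<Delta>\<close> is linear, and
  all identities in \<open>A \<otimes> A\<close> and \<open>A \<otimes> A \<otimes> A\<close> hold, up to equality of tensors.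
  In the counit axioms \<open>A \<otimes> \<bbbK>\<close> and \<open>\<bbbK> \<otimes> A\<close> are identified with \<open>A\<close>.
\<close>

locale hom_coalgebra = vector_space scale
  for scale :: "'k::field \<Rightarrow> 'a::ab_group_add \<Rightarrow> 'a" +
  fixes \<Delta> :: "'a \<Rightarrow> ('a \<times> 'a \<Rightarrow>\<^sub>0 'k)" and \<beta> :: "'a \<Rightarrow> 'a" and \<epsilon> :: "'a \<Rightarrow> 'k"
  assumes Delta_add: "tensor_eq2 scale (\<Delta> (x + y)) (\<Delta> x + \<Delta> y)"
    and Delta_scale: "tensor_eq2 scale (\<Delta> (scale c x)) (free_scale c (\<Delta> x))"
    and beta_linear: "Vector_Spaces.linear scale scale \<beta>"
    and eps_linear: "Vector_Spaces.linear scale (*) \<epsilon>"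
    and hom_coassoc:
      "tensor_eq3 scale (tensor_map_left \<beta> \<Delta> (\<Delta> x)) (tensor_map_right \<Delta> \<beta> (\<Delta> x))"
    and counit_right: "free_ext scale (\<lambda>(a, b). scale (\<epsilon> b) a) (\<Delta> x) = \<beta> x"
    and counit_left: "free_ext scale (\<lambda>(a, b). scale (\<epsilon> a) b) (\<Delta> x) = \<beta> x"
    and eps_beta: "\<epsilon> (\<beta> x) = \<epsilon> x"

locale hom_bialgebra =
  hom_algebra scale \<mu> \<alpha> one + hom_coalgebra scale \<Delta> \<beta> \<epsilon>
  for scale :: "'k::field \<Rightarrow> 'a::ab_group_add \<Rightarrow> 'a"
    and \<mu> :: "'a \<Rightarrow> 'a \<Rightarrow> 'a" and \<alpha> :: "'a \<Rightarrow> 'a" and one :: 'a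
    and \<Delta> :: "'a \<Rightarrow> ('a \<times> 'a \<Rightarrow>\<^sub>0 'k)" and \<beta> :: "'a \<Rightarrow> 'a" and \<epsilon> :: "'a \<Rightarrow> 'k" +
  assumes Delta_mu: "tensor_eq2 scale (\<Delta> (\<mu> x y)) (tensor_mul \<mu> (\<Delta> x) (\<Delta> y))"
    and Delta_one: "tensor_eq2 scale (\<Delta> one) (tens one one)"
    and eps_one: "\<epsilon> one = 1"
    and eps_mu: "\<epsilon> (\<mu> x y) = \<epsilon> x * \<epsilon> y"
    and eps_alpha: "\<epsilon> (\<alpha> x) = \<epsilon> x"
begin

definition conv :: "('a \<Rightarrow> 'a) \<Rightarrow> ('a \<Rightarrow> 'a) \<Rightarrow> 'a \<Rightarrow> 'a" where
  "conv f g x = free_ext scale (\<lambda>(a, b). \<mu> (f a) (g b)) (\<Delta> x)"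

end

text \<open>
  The antipode is an anti-homomorphism of the bialgebra \<open>A\<close>, that is, for the product and for
  the coproduct: \<open>\<Delta> \<circ> S = (S \<otimes> S) \<circ> \<tau> \<circ> \<Delta>\<close> with \<open>\<tau>\<close> the flip. Unlike for ordinary Hopf
  algebras, the latter does not follow from the other axioms, as \<open>\<alpha>\<close> need not be injective:
  for \<open>\<beta> = id\<close>, \<open>\<alpha> x = \<epsilon>(x)\<one>\<close> and \<open>\<mu> x y = \<epsilon>(x)\<epsilon>(y)\<one>\<close> on the span of group-like
  elements \<open>\<one>, g, h\<close>, every linear \<open>S\<close> with \<open>S \<one> = \<one>\<close> and \<open>\<epsilon> \<circ> S = \<epsilon>\<close> satisfies them,
  e.g. one with \<open>S g = \<one> + g - h\<close>, which is not group-like.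
\<close>

locale hom_hopf_algebra = hom_bialgebra scale \<mu> \<alpha> one \<Delta> \<beta> \<epsilon>
  for scale :: "'k::field \<Rightarrow> 'a::ab_group_add \<Rightarrow> 'a"
    and \<mu> :: "'a \<Rightarrow> 'a \<Rightarrow> 'a" and \<alpha> :: "'a \<Rightarrow> 'a" and one :: 'a
    and \<Delta> :: "'a \<Rightarrow> ('a \<times> 'a \<Rightarrow>\<^sub>0 'k)" and \<beta> :: "'a \<Rightarrow> 'a" and \<epsilon> :: "'a \<Rightarrow> 'k" +
  fixes S :: "'a \<Rightarrow> 'a"
  assumes S_linear: "Vector_Spaces.linear scale scale S"
    and S_mu: "S (\<mu> x y) = \<mu> (S y) (S x)"
    and S_Delta: "tensor_eq2 scale (\<Delta> (S x)) (tensor_map S S (tensor_flip (\<Delta> x)))"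
    and S_alpha: "S (\<alpha> x) = \<alpha> (S x)"
    and S_eta: "S (\<eta> c) = \<eta> c"
    and eps_S: "\<epsilon> (S x) = \<epsilon> x"
    and antipode: "\<exists>k::nat. (\<alpha> ^^ k) (conv S id x) = \<eta> (\<epsilon> x) \<and>
                            (\<alpha> ^^ k) (conv id S x) = \<eta> (\<epsilon> x)"
begin

definition inv_index :: "'a \<Rightarrow> nat" where
  "inv_index x = (LEAST k. (\<alpha> ^^ k) (conv S id x) = \<eta> (\<epsilon> x) \<and>
                           (\<alpha> ^^ k) (conv id S x) = \<eta> (\<epsilon> x))"

text \<open>Used on \<open>A[\<nu>]\<close> only, where such a \<open>k\<close> exists.\<close>

definition inv_index_fps :: "'a fps \<Rightarrow> nat" where
  "inv_index_fps g = (LEAST k.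
     (fps_map \<alpha> ^^ k) (fps_map (conv S id) g) = fps_map \<eta> (fps_map \<epsilon> g) \<and>
     (fps_map \<alpha> ^^ k) (fps_map (conv id S) g) = fps_map \<eta> (fps_map \<epsilon> g))"

definition bounded_fps :: "'a fps set" where
  "bounded_fps = {g. \<exists>k. \<forall>i. inv_index (fps_nth g i) \<le> k}"

definition group_likes :: "'a set" where
  "group_likes = {g. tensor_eq2 scale (\<Delta> g) (tens g g) \<and> \<epsilon> g = 1}"

definition formal_group_likes :: "'a fps set" where
  "formal_group_likes = {g \<in> bounded_fps.
     (\<forall>n. tensor_eq2 scale (fps_nth (fps_map \<Delta> g) n) (fps_nth (fps_bilin tens g g) n)) \<and>
     fps_map \<epsilon> g = 1}"

definition p_order_group_likes :: "nat \<Rightarrow> 'a fps set" where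
  "p_order_group_likes p = {g \<in> fps_polys.
     (\<forall>n\<le>p. tensor_eq2 scale (fps_nth (fps_map \<Delta> g) n) (fps_nth (fps_bilin tens g g) n)) \<and>
     fps_map \<epsilon> g = 1}"

definition p_order_rel :: "nat \<Rightarrow> ('a fps \<times> 'a fps) set" where
  "p_order_rel p =
     {(g, h). g \<in> p_order_group_likes p \<and> h \<in> p_order_group_likes p \<and> fps_cong p g h}"

definition formal_sequences :: "(nat \<Rightarrow> 'a fps) set" where
  "formal_sequences = {g. (\<forall>p. g p \<in> fps_polys) \<and>
     (\<forall>p\<ge>1. g p \<in> p_order_group_likes p) \<and>
     (\<forall>p. fps_cong p (g (Suc p)) (fps_map \<alpha> (g p))) \<and>
     (\<exists>k. \<forall>p. inv_index_fps (g p) \<le> k)}"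

definition formal_sequence_rel :: "((nat \<Rightarrow> 'a fps) \<times> (nat \<Rightarrow> 'a fps)) set" where
  "formal_sequence_rel =
     {(g, h). g \<in> formal_sequences \<and> h \<in> formal_sequences \<and> (\<forall>p. fps_cong p (g p) (h p))}"

end

end

theory Submission
  imports Defs
begin

text \<open>
  The laws of a Hom-group other than the one on inverses hold in \<open>A\<close> and, by Cauchy products, in
  \<open>A[[\<nu>]]\<close>, for all elements. What has to be shown is that the four sets are closed under
  the operations and that \<open>g \<or> S g\<close> and \<open>S g \<or> g\<close> become \<open>\<one>\<close> under some
  power of \<open>\<alpha>\<close>.

  Group-likeness passes to products because \<open>\<Delta>\<close> is multiplicative and to antipodes because
  \<open>\<Delta> \<circ> S = (S \<otimes> S) \<circ> \<tau> \<circ> \<Delta>\<close>. For formal series both are statements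
  about single coefficients (\<open>group_like_at_mul\<close>, \<open>group_like_at_S\<close>) that involve only
  coefficients of the same or lower order, so they serve formal and \<open>p\<close>-order group-like
  elements alike. Closure under \<open>\<alpha>\<close> follows from that under products, as
  \<open>\<alpha> g = g \<or> \<one>\<close>. Since coproducts are given by representatives, these arguments
  need that the operations on representatives respect equality of tensors; all of this is the
  universal property \<open>free_ext_tensor_cong_modulo\<close>.

  If \<open>\<Delta> g = g \<otimes> g\<close>, then \<open>(S \<star> id)(g) = S g \<or> g\<close>, so the
  antipode axiom yields the inverse, provided that one power of \<open>\<alpha>\<close> serves all relevant
  coefficients. This is where bounded invertibility indexes enter, and the main point is that
  boundedness is preserved. Elements of index at most \<open>k\<close> form a subspace that \<open>S\<close>
  maps into itself, and a product of two of them has index at most \<open>k + 1\<close>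
  (\<open>invertible_within_mu\<close>). This holds for arbitrary elements of \<open>A\<close>, which is
  essential for sequences: the coefficients of \<open>g\<^sub>p\<close> beyond order \<open>p\<close> are unconstrained
  by group-likeness, yet count towards the invertibility index.

  Finally, \<open>p\<close>-order group-like elements and sequences are taken modulo powers of
  \<open>\<nu>\<close>, a congruence for all operations (\<open>hom_group_quotient\<close>). In a sequence, \<open>g\<^sub>0\<close>
  need not be group-like; but \<open>\<alpha>(g\<^sub>0)\<close> agrees with \<open>g\<^sub>1\<close> modulo \<open>\<nu>\<close>, so one
  further application of \<open>\<alpha>\<close> repairs this.
\<close>


section \<open>Linear extension from a free vector space\<close>

lemma lookup_free_scale: "Poly_Mapping.lookup (free_scale c t) x = c * Poly_Mapping.lookup t x"
  by (simp add: free_scale_def Poly_Mapping.map.rep_eq when_def)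

interpretation free: vector_space "free_scale :: 'k::field \<Rightarrow> ('x \<Rightarrow>\<^sub>0 'k) \<Rightarrow> ('x \<Rightarrow>\<^sub>0 'k)"
  by unfold_locales
    (rule poly_mapping_eqI, simp add: lookup_free_scale lookup_add algebra_simps)+

text \<open>
  For a subspace \<open>W\<close> that represents the zero of a quotient: \<open>W = {0}\<close> gives bilinear
  maps into a space, the span of the tensor relators gives bilinear maps into a tensor product
  of which only representatives are at hand.
\<close>

definition bilinear_modulo ::
    "('k \<Rightarrow> 'a \<Rightarrow> 'a::ab_group_add) \<Rightarrow> ('k \<Rightarrow> 'v \<Rightarrow> 'v::ab_group_add) \<Rightarrow> 'v set \<Rightarrow>
      ('a \<Rightarrow> 'a \<Rightarrow> 'v) \<Rightarrow> bool" where
  "bilinear_modulo sc scale W B \<longleftrightarrow>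
     (\<forall>a a' b. B (a + a') b - B a b - B a' b \<in> W) \<and>
     (\<forall>a b b'. B a (b + b') - B a b - B a b' \<in> W) \<and>
     (\<forall>c a b. B (sc c a) b - scale c (B a b) \<in> W) \<and>
     (\<forall>c a b. B a (sc c b) - scale c (B a b) \<in> W)"

context vector_space
begin

lemma free_ext_superset:
  assumes "finite K" "Poly_Mapping.keys t \<subseteq> K"
  shows "free_ext scale h t = (\<Sum>x\<in>K. scale (Poly_Mapping.lookup t x) (h x))"
  unfolding free_ext_def
  by (rule sum.mono_neutral_left) (use assms in \<open>auto simp: in_keys_iff\<close>)

lemma linear_free_ext: "Vector_Spaces.linear free_scale scale (free_ext scale h)"
proof (rule linear_module_homI, unfold_locales)
  fix t u :: "'c \<Rightarrow>\<^sub>0 'a" and c :: 'a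
  let ?K = "Poly_Mapping.keys t \<union> Poly_Mapping.keys u"
  have "free_ext scale h v = (\<Sum>x\<in>?K. scale (Poly_Mapping.lookup v x) (h x))"
    if "Poly_Mapping.keys v \<subseteq> ?K" for v
    by (rule free_ext_superset) (use that in auto)
  from this[of "t + u"] this[of t] this[of u]
  show "free_ext scale h (t + u) = free_ext scale h t + free_ext scale h u"
    using Poly_Mapping.keys_add[of t u]
    by (simp add: lookup_add scale_left_distrib sum.distrib)
  have "free_ext scale h (free_scale c t)
      = (\<Sum>x\<in>Poly_Mapping.keys t. scale (Poly_Mapping.lookup (free_scale c t) x) (h x))"
    by (rule free_ext_superset) (auto simp: in_keys_iff lookup_free_scale)
  then show "free_ext scale h (free_scale c t) = scale c (free_ext scale h t)"
    by (simp add: lookup_free_scale free_ext_def scale_sum_right)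
qed

lemmas free_ext_add = module_hom.add[OF linear_free_ext[THEN module_hom_linearI]]
  and free_ext_scale = module_hom.scale[OF linear_free_ext[THEN module_hom_linearI]]
  and free_ext_diff = module_hom.diff[OF linear_free_ext[THEN module_hom_linearI]]
  and free_ext_zero = module_hom.zero[OF linear_free_ext[THEN module_hom_linearI]]
  and free_ext_sum = module_hom.sum[OF linear_free_ext[THEN module_hom_linearI]]

lemma free_ext_gen [simp]: "free_ext scale h (gen x) = h x"
  by (simp add: free_ext_def gen_def)

lemma free_ext_tens [simp]: "free_ext scale h (tens a b) = h (a, b)"
  by (simp add: tens_def)

lemma free_ext_in_subspace:
  assumes "subspace W" "\<And>x. h x \<in> W"
  shows "free_ext scale h t \<in> W"
  unfolding free_ext_def by (intro subspace_sum subspace_scale assms)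

lemma linear_image_free_ext:
  assumes "Vector_Spaces.linear scale s' f"
  shows "f (free_ext scale h t) = free_ext s' (\<lambda>x. f (h x)) t"
proof -
  interpret f: Vector_Spaces.linear scale s' f by fact
  show ?thesis unfolding free_ext_def by (simp add: f.sum f.scale)
qed

lemma free_ext_fun_diff:
  "free_ext scale (\<lambda>x. h x - h' x) t = free_ext scale h t - free_ext scale h' t"
  by (simp add: free_ext_def scale_right_diff_distrib sum_subtractf)

lemma free_ext_fun_scale:
  "free_ext scale (\<lambda>x. scale c (h x)) t = scale c (free_ext scale h t)"
  by (simp add: free_ext_def scale_sum_right mult.commute)

lemma free_ext_swap:
  "free_ext scale (\<lambda>x. free_ext scale (\<lambda>y. h x y) u) t
    = free_ext scale (\<lambda>y. free_ext scale (\<lambda>x. h x y) t) u"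
  unfolding free_ext_def scale_sum_right
  by (subst sum.swap) (simp add: mult.commute)

text \<open>
  The universal property of the tensor product: the linear extension of \<open>B\<close> sends each relator
  of multilinearity into \<open>W\<close>, hence the span of the relators as well.
\<close>

lemma free_ext_tensor_cong_modulo:
  assumes W: "subspace W" and B: "bilinear_modulo sc scale W B" and eq: "tensor_eq2 sc t u"
  shows "free_ext scale (\<lambda>(a, b). B a b) t - free_ext scale (\<lambda>(a, b). B a b) u \<in> W"
proof -
  let ?e = "free_ext scale (\<lambda>(a, b). B a b)"
  have sub: "free.subspace {v. ?e v \<in> W}"
    using W by (auto simp: free_ext_zero free_ext_add free_ext_scale subspace_def free.subspace_def)
  have rel: "tensor_relators sc slots2 \<subseteq> {v. ?e v \<in> W}"
    using B
    by (auto simp: tensor_relators_def slots2_def bilinear_modulo_def free_ext_diff free_ext_scale)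
  have "t - u \<in> {v. ?e v \<in> W}"
    using free.span_minimal[OF rel sub] eq by (auto simp: tensor_eq2_def)
  then show ?thesis by (simp add: free_ext_diff)
qed

corollary free_ext_tensor_cong:
  assumes "bilinear_modulo sc scale {0} B" "tensor_eq2 sc t u"
  shows "free_ext scale (\<lambda>(a, b). B a b) t = free_ext scale (\<lambda>(a, b). B a b) u"
  using free_ext_tensor_cong_modulo[OF subspace_single_0 assms] by simp

lemma additive_modulo_sum:
  assumes W: "subspace W" and F: "\<And>a b. F (a + b) - F a - F b \<in> W"
  shows "F (\<Sum>i\<in>I. f i) - (\<Sum>i\<in>I. F (f i)) \<in> W"
proof -
  \<comment> \<open>\<open>F (0 + 0) - F 0 - F 0 = - F 0\<close>\<close>
  have zero: "F 0 \<in> W"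
    using subspace_neg[OF W F[of 0 0]] by simp
  show ?thesis
  proof (induction I rule: infinite_finite_induct)
    case (insert i I)
    from subspace_add[OF W F[of "f i" "\<Sum>i\<in>I. f i"] insert.IH] insert.hyps
    show ?case by (simp add: algebra_simps)
  qed (simp_all add: zero)
qed

lemma linear_compose_bilinear_modulo:
  assumes "bilinear_modulo sc scale W B"
    and "Vector_Spaces.linear sc sc f" "Vector_Spaces.linear sc sc g"
  shows "bilinear_modulo sc scale W (\<lambda>a b. B (f a) (g b))"
  using assms by (simp add: bilinear_modulo_def Vector_Spaces.linear_iff)

lemma bilinear_modulo_flip:
  "bilinear_modulo sc scale W B \<Longrightarrow> bilinear_modulo sc scale W (\<lambda>a b. B b a)"
  by (simp add: bilinear_modulo_def)

end


section \<open>Equality of tensors\<close>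

lemma tensor_eq2_refl [simp]: "tensor_eq2 sc t t"
  by (simp add: tensor_eq2_def free.span_zero)

lemma tensor_eq2_sym: "tensor_eq2 sc t u \<Longrightarrow> tensor_eq2 sc u t"
  unfolding tensor_eq2_def
  by (drule free.span_neg) simp

lemma tensor_eq2_trans [trans]:
  "tensor_eq2 sc t u \<Longrightarrow> tensor_eq2 sc u v \<Longrightarrow> tensor_eq2 sc t v"
  unfolding tensor_eq2_def by (drule (1) free.span_add) simp

lemma tensor_eq2_sum:
  "(\<And>i. i \<in> I \<Longrightarrow> tensor_eq2 sc (t i) (u i)) \<Longrightarrow> tensor_eq2 sc (\<Sum>i\<in>I. t i) (\<Sum>i\<in>I. u i)"
  unfolding tensor_eq2_def by (simp add: free.span_sum flip: sum_subtractf)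

text \<open>
  The subspace by which the free vector space on pairs is divided to give \<open>A \<otimes> A\<close>.
\<close>

abbreviation relator_span ::
    "('k::field \<Rightarrow> 'a \<Rightarrow> 'a::ab_group_add) \<Rightarrow> ('a \<times> 'a \<Rightarrow>\<^sub>0 'k) set" where
  "relator_span sc \<equiv> free.span (tensor_relators sc slots2)"

lemma bilinear_modulo_tens:
  fixes sc :: "'k::field \<Rightarrow> 'a \<Rightarrow> 'a::ab_group_add"
  shows "bilinear_modulo sc free_scale (relator_span sc) tens"
proof -
  have slots: "(\<lambda>a. (a, b)) \<in> slots2" "(\<lambda>b. (a, b)) \<in> slots2" for a b :: 'a
    by (auto simp: slots2_def)
  have "gen (s (a + b)) - gen (s a) - gen (s b) \<in> tensor_relators sc slots2"
    "gen (s (sc c a)) - free_scale c (gen (s a)) \<in> tensor_relators sc slots2"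
    if "s \<in> slots2" for s a b c
    unfolding tensor_relators_def
    by (rule UnI1, rule CollectI, intro exI conjI, rule refl, rule that)
      (rule UnI2, rule CollectI, intro exI conjI, rule refl, rule that)
  from this[OF slots(1)] this[OF slots(2)] show ?thesis
    unfolding bilinear_modulo_def tens_def by (simp add: free.span_base)
qed

lemma tens_sum:
  "tensor_eq2 sc (tens (\<Sum>i\<in>I. f i) (\<Sum>j\<in>J. g j)) (\<Sum>i\<in>I. \<Sum>j\<in>J. tens (f i) (g j))"
proof -
  have "tensor_eq2 sc (tens (\<Sum>i\<in>I. f i) (\<Sum>j\<in>J. g j)) (\<Sum>i\<in>I. tens (f i) (\<Sum>j\<in>J. g j))"
    unfolding tensor_eq2_def
    by (rule free.additive_modulo_sum[where F = "\<lambda>a. tens a (\<Sum>j\<in>J. g j)"])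
      (rule free.subspace_span, rule bilinear_modulo_tens[of sc, unfolded bilinear_modulo_def, THEN conjunct1,
          rule_format])
  also have "tensor_eq2 sc \<dots> (\<Sum>i\<in>I. \<Sum>j\<in>J. tens (f i) (g j))"
  proof (rule tensor_eq2_sum)
    show "tensor_eq2 sc (tens (f i) (\<Sum>j\<in>J. g j)) (\<Sum>j\<in>J. tens (f i) (g j))" for i
      unfolding tensor_eq2_def
      by (rule free.additive_modulo_sum[where F = "tens (f i)"])
        (rule free.subspace_span, rule bilinear_modulo_tens[of sc, unfolded bilinear_modulo_def, THEN conjunct2,
            THEN conjunct1, rule_format])
  qed
  finally show ?thesis .
qed


lemma tensor_map_flip:
  "tensor_map f g (tensor_flip t) = free_ext free_scale (\<lambda>(a, b). tens (f b) (g a)) t"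
  unfolding tensor_map_def tensor_flip_def
  by (subst free.linear_image_free_ext[OF free.linear_free_ext]) (simp add: case_prod_unfold)

lemma tensor_map_flip_cong:
  assumes "Vector_Spaces.linear sc sc f" "Vector_Spaces.linear sc sc g" "tensor_eq2 sc t u"
  shows "tensor_eq2 sc (tensor_map f g (tensor_flip t)) (tensor_map f g (tensor_flip u))"
proof -
  have "bilinear_modulo sc free_scale (relator_span sc) (\<lambda>a b. tens (f b) (g a))"
    using free.linear_compose_bilinear_modulo[OF bilinear_modulo_tens assms(1,2)]
    by (rule free.bilinear_modulo_flip)
  then show ?thesis
    unfolding tensor_map_flip tensor_eq2_def
    by (rule free.free_ext_tensor_cong_modulo[OF free.subspace_span _ assms(3)])
qed

lemma tensor_mul_tens: "tensor_mul m (tens a b) (tens c d) = tens (m a c) (m b d)"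
  by (simp add: tensor_mul_def)

lemma tensor_mul_sum:
  "tensor_mul m (\<Sum>i\<in>I. t i) (\<Sum>j\<in>J. u j) = (\<Sum>i\<in>I. \<Sum>j\<in>J. tensor_mul m (t i) (u j))"
proof -
  have right: "tensor_mul m t' (\<Sum>j\<in>J. u j) = (\<Sum>j\<in>J. tensor_mul m t' (u j))" for t'
    unfolding tensor_mul_def free_ext_def[of _ _ t'] free.free_ext_sum case_prod_unfold
    by (subst sum.swap) (simp add: free.scale_sum_right)
  have left: "tensor_mul m (\<Sum>i\<in>I. t i) u' = (\<Sum>i\<in>I. tensor_mul m (t i) u')" for u'
    unfolding tensor_mul_def by (rule free.free_ext_sum)
  show ?thesis unfolding left by (simp only: right)
qed


section \<open>Hom-algebras\<close>

context hom_algebra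
begin

interpretation left: Vector_Spaces.linear scale scale "\<lambda>x. \<mu> x y" for y
  by (rule mu_linear_left)

interpretation right: Vector_Spaces.linear scale scale "\<mu> x" for x
  by (rule mu_linear_right)

interpretation alpha: Vector_Spaces.linear scale scale \<alpha>
  by (rule alpha_linear)

lemmas mu_add_left = left.add and mu_scale_left = left.scale and mu_sum_left = left.sum
  and mu_zero_left = left.zero and mu_add_right = right.add and mu_scale_right = right.scale
  and mu_sum_right = right.sum and mu_zero_right = right.zero
  and alpha_sum = alpha.sum and alpha_scale = alpha.scale and alpha_zero = alpha.zero

lemma mu_bilinear: "bilinear_modulo scale scale {0} \<mu>"
  by (simp add: bilinear_modulo_def mu_add_left mu_add_right mu_scale_left mu_scale_right)

lemma alpha_pow_linear: "Vector_Spaces.linear scale scale (\<alpha> ^^ k)"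
proof (induction k)
  case 0 then show ?case by (simp add: Vector_Spaces.linear_iff vector_space_axioms)
next
  case (Suc k) then show ?case using Vector_Spaces.linear_compose[OF Suc alpha_linear] by (simp add: o_def)
qed

lemma alpha_pow_mu: "(\<alpha> ^^ k) (\<mu> x y) = \<mu> ((\<alpha> ^^ k) x) ((\<alpha> ^^ k) y)"
  by (induction k) (simp_all add: alpha_mu)

lemma alpha_pow_eta: "(\<alpha> ^^ k) (\<eta> c) = \<eta> c"
  by (induction k) (simp_all add: \<eta>_def alpha_scale alpha_one)

text \<open>
  Hom-associativity applies to \<open>(a \<or> b) \<or> \<alpha> e\<close> only, so it takes one application of
  \<open>\<alpha>\<close> beyond \<open>\<alpha>\<^sup>k\<close> to bring the two inner factors together. With
  \<open>b\<close> and \<open>c\<close> mutually inverse, the middle collapses; hence the increment in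
  \<open>invertible_within_mu\<close>.
\<close>

lemma alpha_pow_mu_middle:
  "(\<alpha> ^^ Suc k) (\<mu> (\<mu> a b) (\<mu> c d))
    = \<mu> ((\<alpha> ^^ Suc (Suc k)) a) (\<mu> ((\<alpha> ^^ k) (\<mu> b c)) ((\<alpha> ^^ Suc k) d))"
proof -
  have "(\<alpha> ^^ Suc k) (\<mu> (\<mu> a b) (\<mu> c d))
      = \<mu> (\<mu> ((\<alpha> ^^ Suc k) a) ((\<alpha> ^^ Suc k) b)) (\<alpha> ((\<alpha> ^^ k) (\<mu> c d)))"
    by (simp add: alpha_pow_mu alpha_mu)
  also have "\<dots> = \<mu> (\<alpha> ((\<alpha> ^^ Suc k) a)) (\<mu> ((\<alpha> ^^ Suc k) b) ((\<alpha> ^^ k) (\<mu> c d)))"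
    by (rule hom_assoc[symmetric])
  also have "\<mu> ((\<alpha> ^^ Suc k) b) ((\<alpha> ^^ k) (\<mu> c d))
      = \<mu> ((\<alpha> ^^ k) (\<mu> b c)) ((\<alpha> ^^ Suc k) d)"
    by (simp add: alpha_pow_mu hom_assoc)
  finally show ?thesis by simp
qed

text \<open>
  The product is linear in either tensor, so it is enough to see that multiplying a generator
  by a fixed tensor is bilinear modulo the relators.
\<close>

lemma tensor_mul_cong:
  assumes t: "tensor_eq2 scale t t'" and u: "tensor_eq2 scale u u'"
  shows "tensor_eq2 scale (tensor_mul \<mu> t u) (tensor_mul \<mu> t' u')"
proof -
  define E where "E = (\<lambda>a b. free_ext (free_scale :: 'k \<Rightarrow> _) (\<lambda>(c, d). tens (\<mu> a c) (\<mu> b d)))"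
  have mul: "tensor_mul \<mu> v w = free_ext free_scale (\<lambda>(a, b). E a b w) v" for v w
    by (simp add: tensor_mul_def E_def)
  have E_right: "E a b u - E a b u' \<in> relator_span scale" for a b
    unfolding E_def
    by (rule free.free_ext_tensor_cong_modulo[OF free.subspace_span _ u])
      (rule free.linear_compose_bilinear_modulo[OF bilinear_modulo_tens
          mu_linear_right mu_linear_right])
  have "bilinear_modulo scale free_scale (relator_span scale) (\<lambda>a b. E a b u)"
    using bilinear_modulo_tens[of scale]
    unfolding bilinear_modulo_def E_def
      free.free_ext_fun_diff[symmetric] free.free_ext_fun_scale[symmetric]
    by (intro conjI allI free.free_ext_in_subspace free.subspace_span)
      (auto simp: mu_add_left mu_scale_left)
  then have "tensor_eq2 scale (tensor_mul \<mu> t u) (tensor_mul \<mu> t' u)"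
    unfolding mul tensor_eq2_def
    by (rule free.free_ext_tensor_cong_modulo[OF free.subspace_span _ t])
  also have "tensor_eq2 scale \<dots> (tensor_mul \<mu> t' u')"
    unfolding mul tensor_eq2_def free.free_ext_fun_diff[symmetric]
    by (rule free.free_ext_in_subspace[OF free.subspace_span]) (auto simp: E_right)
  finally show ?thesis .
qed

end


section \<open>Formal series over a Hom-algebra\<close>

lemma nth_fps_map [simp]: "fps_nth (fps_map f g) n = f (fps_nth g n)"
  by (simp add: fps_map_def)

lemma nth_fps_bilin:
  "fps_nth (fps_bilin B g h) n = (\<Sum>i=0..n. B (fps_nth g i) (fps_nth h (n - i)))"
  by (simp add: fps_bilin_def)

lemma fps_map_id [simp]: "fps_map id g = g"
  by (simp add: fps_eq_iff)

lemma fps_map_pow: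
  fixes f :: "'a \<Rightarrow> 'a"
  shows "(fps_map f ^^ k) g = fps_map (f ^^ k) g"
  by (induction k) (simp_all add: fps_eq_iff)

lemma fps_map_const: "f 0 = 0 \<Longrightarrow> fps_map f (fps_const c) = fps_const (f c)"
  by (simp add: fps_eq_iff)

lemma fps_map_polys: "f 0 = 0 \<Longrightarrow> g \<in> fps_polys \<Longrightarrow> fps_map f g \<in> fps_polys"
  unfolding fps_polys_def by (auto elim!: rev_finite_subset)

lemma fps_const_polys: "fps_const c \<in> fps_polys"
  unfolding fps_polys_def by (rule CollectI, rule finite_subset[of _ "{0}"]) auto

lemma fps_bilin_polys:
  assumes "\<And>y. B 0 y = 0" "\<And>x. B x 0 = 0" "g \<in> fps_polys" "h \<in> fps_polys"
  shows "fps_bilin B g h \<in> fps_polys"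
proof -
  let ?s = "\<lambda>f. {n. fps_nth f n \<noteq> 0}"
  have "n \<in> (\<lambda>(i, j). i + j) ` (?s g \<times> ?s h)" if "fps_nth (fps_bilin B g h) n \<noteq> 0" for n
  proof -
    from that obtain i where "i \<le> n" "B (fps_nth g i) (fps_nth h (n - i)) \<noteq> 0"
      by (auto simp: nth_fps_bilin elim!: sum.not_neutral_contains_not_neutral)
    then show ?thesis
      using assms(1,2) by (intro image_eqI[of _ _ "(i, n - i)"]) auto
  qed
  then have "?s (fps_bilin B g h) \<subseteq> (\<lambda>(i, j). i + j) ` (?s g \<times> ?s h)" by blast
  moreover have "finite ((\<lambda>(i, j). i + j) ` (?s g \<times> ?s h))"
    using assms(3,4) by (simp add: fps_polys_def)
  ultimately show ?thesis
    unfolding fps_polys_def by (blast intro: finite_subset)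
qed

lemma equivp_fps_cong: "equivp (fps_cong p)"
  by (rule equivpI) (auto simp: reflp_def symp_def transp_def fps_cong_def)

lemma fps_cong_map: "fps_cong p g h \<Longrightarrow> fps_cong p (fps_map f g) (fps_map f h)"
  by (simp add: fps_cong_def)

lemma fps_cong_bilin:
  "fps_cong p g g' \<Longrightarrow> fps_cong p h h' \<Longrightarrow> fps_cong p (fps_bilin B g h) (fps_bilin B g' h')"
  by (auto simp: fps_cong_def nth_fps_bilin intro!: sum.cong)

context hom_algebra
begin

lemma fps_alpha_mul:
  "fps_map \<alpha> (fps_bilin \<mu> g h) = fps_bilin \<mu> (fps_map \<alpha> g) (fps_map \<alpha> h)"
  by (simp add: fps_eq_iff nth_fps_bilin alpha_sum alpha_mu)

lemma fps_hom_assoc: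
  "fps_bilin \<mu> (fps_map \<alpha> g) (fps_bilin \<mu> h l) = fps_bilin \<mu> (fps_bilin \<mu> g h) (fps_map \<alpha> l)"
  using fps_mult_assoc_lemma[of "\<lambda>i j k. \<mu> (\<mu> (fps_nth g i) (fps_nth h j)) (\<alpha> (fps_nth l k))"]
  by (simp add: fps_eq_iff nth_fps_bilin mu_sum_left mu_sum_right hom_assoc)

lemma fps_mul_one: "fps_bilin \<mu> g (fps_const one) = fps_map \<alpha> g"
proof (rule fps_ext)
  fix n
  have "fps_nth (fps_bilin \<mu> g (fps_const one)) n = (\<Sum>i=0..n. if i = n then \<alpha> (fps_nth g i) else 0)"
    unfolding nth_fps_bilin by (rule sum.cong) (auto simp: mu_one mu_zero_right)
  then show "fps_nth (fps_bilin \<mu> g (fps_const one)) n = fps_nth (fps_map \<alpha> g) n" by simp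
qed

lemma fps_one_mul: "fps_bilin \<mu> (fps_const one) g = fps_map \<alpha> g"
proof (rule fps_ext)
  fix n
  have "fps_nth (fps_bilin \<mu> (fps_const one) g) n
      = (\<Sum>i=0..n. if i = 0 then \<alpha> (fps_nth g n) else 0)"
    unfolding nth_fps_bilin by (rule sum.cong) (auto simp: one_mu mu_zero_left)
  then show "fps_nth (fps_bilin \<mu> (fps_const one) g) n = fps_nth (fps_map \<alpha> g) n" by simp
qed

lemma fps_alpha_one: "fps_map \<alpha> (fps_const one) = fps_const one"
  by (simp add: fps_map_const alpha_zero alpha_one)

lemma fps_mul_polys: "g \<in> fps_polys \<Longrightarrow> h \<in> fps_polys \<Longrightarrow> fps_bilin \<mu> g h \<in> fps_polys"
  by (rule fps_bilin_polys) (simp_all add: mu_zero_left mu_zero_right)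

end


section \<open>The coproduct and the invertibility index\<close>

context hom_hopf_algebra
begin

interpretation S: Vector_Spaces.linear scale scale S
  by (rule S_linear)

interpretation eps: Vector_Spaces.linear scale "(*)" \<epsilon>
  by (rule eps_linear)

interpretation alpha_pow: Vector_Spaces.linear scale scale "\<alpha> ^^ k" for k
  by (rule alpha_pow_linear)

lemma linear_id_scale: "Vector_Spaces.linear scale scale id"
  by (simp add: Vector_Spaces.linear_iff vector_space_axioms)

lemma S_one: "S one = one"
  using S_eta[of 1] by (simp add: \<eta>_def)

lemma Delta_sum: "tensor_eq2 scale (\<Delta> (\<Sum>i\<in>I. f i)) (\<Sum>i\<in>I. \<Delta> (f i))"
  unfolding tensor_eq2_def
  by (rule free.additive_modulo_sum[OF free.subspace_span])
    (use Delta_add in \<open>simp add: tensor_eq2_def diff_diff_eq\<close>)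

text \<open>
  In Sweedler notation,
  \<open>\<Sum> B ((xy)\<^sub>1) ((xy)\<^sub>2) = \<Sum> B (x\<^sub>1 y\<^sub>1) (x\<^sub>2 y\<^sub>2)\<close>.
\<close>

lemma free_ext_Delta_mu:
  assumes "bilinear_modulo scale scale {0} B"
  shows "free_ext scale (\<lambda>(a, b). B a b) (\<Delta> (\<mu> x y))
    = free_ext scale (\<lambda>(a, b). free_ext scale (\<lambda>(c, d). B (\<mu> a c) (\<mu> b d)) (\<Delta> y)) (\<Delta> x)"
  unfolding free_ext_tensor_cong[OF assms Delta_mu] tensor_mul_def
  by (simp add: free.linear_image_free_ext[OF linear_free_ext] case_prod_unfold)

text \<open>
  In Sweedler notation,
  \<open>\<Sum> B ((S x)\<^sub>1) ((S x)\<^sub>2) = \<Sum> B (S x\<^sub>2) (S x\<^sub>1)\<close>.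
\<close>

lemma free_ext_Delta_S:
  assumes "bilinear_modulo scale scale {0} B"
  shows "free_ext scale (\<lambda>(a, b). B a b) (\<Delta> (S x))
    = free_ext scale (\<lambda>(a, b). B (S b) (S a)) (\<Delta> x)"
  unfolding free_ext_tensor_cong[OF assms S_Delta] tensor_map_flip
  by (simp add: free.linear_image_free_ext[OF linear_free_ext] case_prod_unfold)

lemma conv_bilinear:
  assumes "Vector_Spaces.linear scale scale f" "Vector_Spaces.linear scale scale g"
  shows "bilinear_modulo scale scale {0} (\<lambda>a b. \<mu> (f a) (g b))"
  by (rule linear_compose_bilinear_modulo[OF mu_bilinear assms])

lemma conv_cong:
  assumes "Vector_Spaces.linear scale scale f" "Vector_Spaces.linear scale scale g"
    and "tensor_eq2 scale (\<Delta> x) t"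
  shows "conv f g x = free_ext scale (\<lambda>(a, b). \<mu> (f a) (g b)) t"
  unfolding conv_def by (rule free_ext_tensor_cong[OF conv_bilinear[OF assms(1,2)] assms(3)])

lemma conv_linear:
  assumes "Vector_Spaces.linear scale scale f" "Vector_Spaces.linear scale scale g"
  shows "Vector_Spaces.linear scale scale (conv f g)"
  by (rule linear_module_homI, unfold_locales)
    (simp_all add: conv_cong[OF assms Delta_add] conv_cong[OF assms Delta_scale]
      free_ext_add free_ext_scale flip: conv_def)

interpretation conv_S_id: Vector_Spaces.linear scale scale "conv S id"
  by (rule conv_linear[OF S_linear linear_id_scale])

interpretation conv_id_S: Vector_Spaces.linear scale scale "conv id S"
  by (rule conv_linear[OF linear_id_scale S_linear])

text \<open>
  The condition whose least solution is the invertibility index. Its solutions for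
  fixed \<open>k\<close> form a subspace, which is easier to see than the corresponding bound on the index.
\<close>

definition invertible_within :: "nat \<Rightarrow> 'a \<Rightarrow> bool" where
  "invertible_within k x \<longleftrightarrow>
     (\<alpha> ^^ k) (conv S id x) = \<eta> (\<epsilon> x) \<and> (\<alpha> ^^ k) (conv id S x) = \<eta> (\<epsilon> x)"

lemma invertible_within_mono:
  assumes "invertible_within k x" "k \<le> l"
  shows "invertible_within l x"
proof -
  have "(\<alpha> ^^ l) y = (\<alpha> ^^ (l - k)) ((\<alpha> ^^ k) y)" for y
    using assms(2) by (simp flip: comp_apply[of "\<alpha> ^^ (l - k)"] funpow_add)
  then show ?thesis
    using assms(1) by (simp add: invertible_within_def alpha_pow_eta)
qed

lemma invertible_within_zero: "invertible_within k 0"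
  by (simp add: invertible_within_def \<eta>_def)

lemma invertible_within_one: "invertible_within k one"
  by (simp add: invertible_within_def conv_cong[OF S_linear linear_id_scale Delta_one]
      conv_cong[OF linear_id_scale S_linear Delta_one] S_one mu_one alpha_one eps_one
      alpha_pow_eta[of k 1, unfolded \<eta>_def, simplified] \<eta>_def)

lemma invertible_within_sum:
  "(\<And>i. i \<in> I \<Longrightarrow> invertible_within k (x i)) \<Longrightarrow> invertible_within k (\<Sum>i\<in>I. x i)"
  by (simp add: invertible_within_def conv_S_id.sum conv_id_S.sum alpha_pow.sum eps.sum \<eta>_def
      scale_sum_left)

text \<open>
  \<open>S\<close> exchanges the two convolutions:
  \<open>(S \<star> id) \<circ> S = S \<circ> (id \<star> S)\<close>, since
  \<open>S (S x\<^sub>2) \<or> S x\<^sub>1 = S (x\<^sub>1 \<or> S x\<^sub>2)\<close>.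
\<close>

lemma invertible_within_S:
  assumes "invertible_within k x"
  shows "invertible_within k (S x)"
proof -
  have S_pow: "S ((\<alpha> ^^ k) y) = (\<alpha> ^^ k) (S y)" for y
    by (induction k) (simp_all add: S_alpha)
  have "conv S id (S x) = S (conv id S x)" "conv id S (S x) = S (conv S id x)"
    unfolding conv_def
      free_ext_Delta_S[OF conv_bilinear[OF S_linear linear_id_scale]]
      free_ext_Delta_S[OF conv_bilinear[OF linear_id_scale S_linear]]
      linear_image_free_ext[OF S_linear]
    by (simp_all add: case_prod_unfold S_mu)
  then show ?thesis
    using assms by (simp add: invertible_within_def S_eta eps_S flip: S_pow)
qed

text \<open>
  The convolution \<open>(S \<star> id)(xy)\<close> is the sum of
  \<open>(S y\<^sub>1 \<or> S x\<^sub>1) \<or> (x\<^sub>2 \<or> y\<^sub>2)\<close>. Under \<open>\<alpha>\<^sup>k\<^sup>+\<^sup>1\<close> the inner factors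
  meet as \<open>\<alpha>\<^sup>k(S x\<^sub>1 \<or> x\<^sub>2)\<close>, which sum to \<open>\<epsilon>(x)\<one>\<close>; what is left is
  \<open>\<epsilon>(x)\<close> times \<open>\<alpha>\<^sup>k\<^sup>+\<^sup>2(S y\<^sub>1 \<or> y\<^sub>2)\<close>. For \<open>id \<star> S\<close> the roles
  of \<open>x\<close> and \<open>y\<close> are exchanged.
\<close>

lemma invertible_within_mu:
  assumes x: "invertible_within k x" and y: "invertible_within k y"
  shows "invertible_within (Suc k) (\<mu> x y)"
proof -
  have mid: "Vector_Spaces.linear scale scale (\<lambda>z. \<mu> p (\<mu> ((\<alpha> ^^ k) z) q))" for p q
    by (simp add: Vector_Spaces.linear_iff vector_space_axioms alpha_pow.add alpha_pow.scale
        mu_add_left mu_add_right mu_scale_left mu_scale_right)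
  \<comment> \<open>The form left by \<open>alpha_pow_mu_middle\<close> once the middle has become \<open>e \<one>\<close>.\<close>
  have collapse: "\<mu> ((\<alpha> ^^ Suc (Suc k)) a) (\<mu> (\<eta> e) ((\<alpha> ^^ Suc k) d))
      = scale e ((\<alpha> ^^ Suc (Suc k)) (\<mu> a d))" for a d e
    by (simp add: \<eta>_def mu_scale_left mu_scale_right one_mu alpha_pow_mu alpha_mu)
  have y': "(\<alpha> ^^ Suc (Suc k)) (conv S id y) = \<eta> (\<epsilon> y)"
    using invertible_within_mono[OF y, of "Suc (Suc k)"] by (simp add: invertible_within_def)
  have x': "(\<alpha> ^^ Suc (Suc k)) (conv id S x) = \<eta> (\<epsilon> x)"
    using invertible_within_mono[OF x, of "Suc (Suc k)"] by (simp add: invertible_within_def)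
  have "(\<alpha> ^^ Suc k) (conv S id (\<mu> x y))
      = free_ext scale (\<lambda>p. free_ext scale (\<lambda>q.
          (\<alpha> ^^ Suc k) (\<mu> (\<mu> (S (fst q)) (S (fst p))) (\<mu> (snd p) (snd q)))) (\<Delta> y)) (\<Delta> x)"
    unfolding conv_def free_ext_Delta_mu[OF conv_bilinear[OF S_linear linear_id_scale]]
    unfolding linear_image_free_ext[OF alpha_pow_linear] case_prod_unfold S_mu id_apply ..
  also have "\<dots> = free_ext scale (\<lambda>q. free_ext scale (\<lambda>p.
      (\<alpha> ^^ Suc k) (\<mu> (\<mu> (S (fst q)) (S (fst p))) (\<mu> (snd p) (snd q)))) (\<Delta> x)) (\<Delta> y)"
    by (rule free_ext_swap)
  also have "\<dots> = free_ext scale (\<lambda>q. \<mu> ((\<alpha> ^^ Suc (Suc k)) (S (fst q)))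
      (\<mu> ((\<alpha> ^^ k) (conv S id x)) ((\<alpha> ^^ Suc k) (snd q)))) (\<Delta> y)"
    unfolding conv_def linear_image_free_ext[OF mid] alpha_pow_mu_middle case_prod_unfold id_apply ..
  also have "\<dots> = scale (\<epsilon> x) ((\<alpha> ^^ Suc (Suc k)) (conv S id y))"
    unfolding x[unfolded invertible_within_def, THEN conjunct1] collapse free_ext_fun_scale
    unfolding conv_def linear_image_free_ext[OF alpha_pow_linear] case_prod_unfold id_apply ..
  finally have S_id: "(\<alpha> ^^ Suc k) (conv S id (\<mu> x y)) = \<eta> (\<epsilon> (\<mu> x y))"
    unfolding y' by (simp add: \<eta>_def eps_mu)
  have "(\<alpha> ^^ Suc k) (conv id S (\<mu> x y))
      = free_ext scale (\<lambda>p. free_ext scale (\<lambda>q.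
          (\<alpha> ^^ Suc k) (\<mu> (\<mu> (fst p) (fst q)) (\<mu> (S (snd q)) (S (snd p))))) (\<Delta> y)) (\<Delta> x)"
    unfolding conv_def free_ext_Delta_mu[OF conv_bilinear[OF linear_id_scale S_linear]]
    unfolding linear_image_free_ext[OF alpha_pow_linear] case_prod_unfold S_mu id_apply ..
  also have "\<dots> = free_ext scale (\<lambda>p. \<mu> ((\<alpha> ^^ Suc (Suc k)) (fst p))
      (\<mu> ((\<alpha> ^^ k) (conv id S y)) ((\<alpha> ^^ Suc k) (S (snd p))))) (\<Delta> x)"
    unfolding conv_def linear_image_free_ext[OF mid] alpha_pow_mu_middle case_prod_unfold id_apply ..
  also have "\<dots> = scale (\<epsilon> y) ((\<alpha> ^^ Suc (Suc k)) (conv id S x))"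
    unfolding y[unfolded invertible_within_def, THEN conjunct2] collapse free_ext_fun_scale
    unfolding conv_def linear_image_free_ext[OF alpha_pow_linear] case_prod_unfold id_apply ..
  finally have "(\<alpha> ^^ Suc k) (conv id S (\<mu> x y)) = \<eta> (\<epsilon> (\<mu> x y))"
    unfolding x' by (simp add: \<eta>_def eps_mu mult.commute)
  with S_id show ?thesis by (simp only: invertible_within_def)
qed

lemma inv_index_le_iff: "inv_index x \<le> k \<longleftrightarrow> invertible_within k x"
proof
  have "invertible_within (inv_index x) x"
    unfolding inv_index_def invertible_within_def by (rule LeastI_ex) (rule antipode)
  then show "inv_index x \<le> k \<Longrightarrow> invertible_within k x" by (rule invertible_within_mono)
  show "invertible_within k x \<Longrightarrow> inv_index x \<le> k"
    unfolding inv_index_def invertible_within_def by (rule Least_le)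
qed

text \<open>
  Finitely many coefficients are nonzero, so their indexes have a maximum; for series in general
  the least \<open>k\<close> need not exist.
\<close>

lemma inv_index_fps_le_iff:
  assumes "g \<in> fps_polys"
  shows "inv_index_fps g \<le> k \<longleftrightarrow> (\<forall>n. invertible_within k (fps_nth g n))"
proof -
  let ?P = "\<lambda>k. \<forall>n. invertible_within k (fps_nth g n)"
  have index: "inv_index_fps g = (LEAST k. ?P k)"
    unfolding inv_index_fps_def invertible_within_def fps_map_pow fps_eq_iff nth_fps_map
    by (simp only: all_conj_distrib)
  have "?P (Max (inv_index ` fps_nth g ` {n. fps_nth g n \<noteq> 0}))"
  proof
    fix n
    show "invertible_within (Max (inv_index ` fps_nth g ` {n. fps_nth g n \<noteq> 0})) (fps_nth g n)"
      using assms by (cases "fps_nth g n = 0")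
        (simp add: invertible_within_zero, auto simp: fps_polys_def simp flip: inv_index_le_iff)
  qed
  then have "?P (inv_index_fps g)" unfolding index by (rule LeastI)
  then have "inv_index_fps g \<le> k \<Longrightarrow> ?P k" using invertible_within_mono by blast
  moreover have "?P k \<Longrightarrow> inv_index_fps g \<le> k" unfolding index by (rule Least_le)
  ultimately show ?thesis by blast
qed

end


section \<open>Formal series with group-like coefficients\<close>

text \<open>
  Either side sums \<open>F a b c d\<close> over \<open>a + b + c + d = n\<close>, grouped as
  \<open>(a + b) + (c + d)\<close> and as \<open>(a + c) + (b + d)\<close>. This matches
  \<open>(g \<otimes> g)(h \<otimes> h)\<close> with \<open>gh \<otimes> gh\<close>.
\<close>

lemma sum_medial:
  fixes F :: "nat \<Rightarrow> nat \<Rightarrow> nat \<Rightarrow> nat \<Rightarrow> 'b::comm_monoid_add"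
  shows "(\<Sum>i=0..n. \<Sum>j=0..i. \<Sum>l=0..n - i. F j (i - j) l (n - i - l))
    = (\<Sum>i=0..n. \<Sum>j=0..i. \<Sum>l=0..n - i. F j l (i - j) (n - i - l))"
proof -
  let ?K = "SIGMA i:{0..n}. {0..i} \<times> {0..n - i}"
  have "(\<Sum>(i, j, l)\<in>?K. F j (i - j) l (n - i - l)) = (\<Sum>(i, j, l)\<in>?K. F j l (i - j) (n - i - l))"
    \<comment> \<open>Exchanging \<open>b = i - j\<close> with \<open>c = l\<close> is an involution of the index set.\<close>
    by (rule sum.reindex_bij_witness[where i = "\<lambda>(i, j, l). (j + l, j, i - j)"
          and j = "\<lambda>(i, j, l). (j + l, j, i - j)"])
      (auto simp: add.commute)
  then show ?thesis
    by (simp add: sum.Sigma case_prod_unfold)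
qed

context hom_hopf_algebra
begin

text \<open>
  The part of \<open>\<Delta> g = g \<otimes> g\<close> at order \<open>\<nu>\<^sup>n\<close>.
\<close>

definition group_like_at :: "'a fps \<Rightarrow> nat \<Rightarrow> bool" where
  "group_like_at g n \<longleftrightarrow>
     tensor_eq2 scale (fps_nth (fps_map \<Delta> g) n) (fps_nth (fps_bilin tens g g) n)"

lemma group_like_at_one: "group_like_at (fps_const one) n"
proof -
  have zero: "tensor_eq2 scale (\<Delta> 0) 0"
    using Delta_sum[of "\<lambda>_. 0" "{}"] by simp
  have tens_zero: "tensor_eq2 scale (tens a b) 0" if "a = 0 \<or> b = 0" for a b
    using that tens_sum[of scale "\<lambda>_. 0" "{}" "\<lambda>_. b" "{()}"]
      tens_sum[of scale "\<lambda>_. a" "{()}" "\<lambda>_. 0" "{}"] by auto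
  show ?thesis
  proof (cases "n = 0")
    case True
    then show ?thesis by (simp add: group_like_at_def nth_fps_bilin Delta_one)
  next
    case False
    have "tensor_eq2 scale (fps_nth (fps_bilin tens (fps_const one) (fps_const one)) n)
        (\<Sum>i=0..n. 0)"
      unfolding nth_fps_bilin by (rule tensor_eq2_sum, rule tens_zero) (use False in auto)
    from tensor_eq2_trans[OF zero tensor_eq2_sym[OF this[unfolded sum.neutral_const]]] False
    show ?thesis by (simp add: group_like_at_def)
  qed
qed

lemma group_like_at_mul:
  assumes "\<And>m. m \<le> n \<Longrightarrow> group_like_at g m" "\<And>m. m \<le> n \<Longrightarrow> group_like_at h m"
  shows "group_like_at (fps_bilin \<mu> g h) n"
proof -
  let ?T = "\<lambda>g n. \<Sum>i=0..n. tens (fps_nth g i) (fps_nth g (n - i)) :: 'a \<times> 'a \<Rightarrow>\<^sub>0 'k"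
  let ?m = "\<lambda>i j. \<mu> (fps_nth g i) (fps_nth h j)"
  have D: "tensor_eq2 scale (\<Delta> (fps_nth g m)) (?T g m)" "tensor_eq2 scale (\<Delta> (fps_nth h m)) (?T h m)"
    if "m \<le> n" for m
    using assms[OF that] by (simp_all add: group_like_at_def nth_fps_bilin)
  have "tensor_eq2 scale (\<Delta> (\<Sum>i=0..n. ?m i (n - i))) (\<Sum>i=0..n. \<Delta> (?m i (n - i)))"
    by (rule Delta_sum)
  also have "tensor_eq2 scale \<dots> (\<Sum>i=0..n. tensor_mul \<mu> (?T g i) (?T h (n - i)))"
    by (intro tensor_eq2_sum tensor_eq2_trans[OF Delta_mu] tensor_mul_cong D) auto
  also have "(\<Sum>i=0..n. tensor_mul \<mu> (?T g i) (?T h (n - i)))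
      = (\<Sum>i=0..n. \<Sum>j=0..i. \<Sum>l=0..n - i. tens (?m j l) (?m (i - j) (n - i - l)))"
    by (simp add: tensor_mul_sum tensor_mul_tens)
  also have "\<dots> = (\<Sum>i=0..n. \<Sum>j=0..i. \<Sum>l=0..n - i. tens (?m j (i - j)) (?m l (n - i - l)))"
    by (rule sum_medial[where F = "\<lambda>a b c d. tens (?m a c) (?m b d)"])
  also have "tensor_eq2 scale \<dots>
      (\<Sum>i=0..n. tens (\<Sum>j=0..i. ?m j (i - j)) (\<Sum>l=0..n - i. ?m l (n - i - l)))"
    by (intro tensor_eq2_sum tensor_eq2_sym[OF tens_sum])
  finally show ?thesis by (simp add: group_like_at_def nth_fps_bilin)
qed

lemma sum_atLeast0_reflect: "(\<Sum>i=0..n. f i (n - i)) = (\<Sum>i=0..n. f (n - i) i)"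
  for f :: "nat \<Rightarrow> nat \<Rightarrow> 'b::comm_monoid_add"
  by (subst sum.atLeastAtMost_rev) (auto intro!: sum.cong)

lemma group_like_at_S:
  assumes "group_like_at g n"
  shows "group_like_at (fps_map S g) n"
proof -
  have "tensor_eq2 scale (\<Delta> (S (fps_nth g n))) (tensor_map S S (tensor_flip (\<Delta> (fps_nth g n))))"
    by (rule S_Delta)
  also have "tensor_eq2 scale \<dots>
      (tensor_map S S (tensor_flip (\<Sum>i=0..n. tens (fps_nth g i) (fps_nth g (n - i)))))"
    using assms by (intro tensor_map_flip_cong S_linear) (simp add: group_like_at_def nth_fps_bilin)
  also have "tensor_map S S (tensor_flip (\<Sum>i=0..n. tens (fps_nth g i) (fps_nth g (n - i))))
      = (\<Sum>i=0..n. tens (S (fps_nth g (n - i))) (S (fps_nth g i)))"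
    by (simp add: tensor_map_flip free.free_ext_sum)
  also have "\<dots> = (\<Sum>i=0..n. tens (S (fps_nth g i)) (S (fps_nth g (n - i))))"
    by (rule sum_atLeast0_reflect[symmetric])
  finally show ?thesis by (simp add: group_like_at_def nth_fps_bilin)
qed

text \<open>
  At a coefficient where \<open>g\<close> is group-like, convolution turns into the product of series.
\<close>

lemma conv_group_like_at:
  assumes "Vector_Spaces.linear scale scale f" "Vector_Spaces.linear scale scale h"
    and "group_like_at g n"
  shows "conv f h (fps_nth g n) = fps_nth (fps_bilin \<mu> (fps_map f g) (fps_map h g)) n"
  using conv_cong[OF assms(1,2) assms(3)[unfolded group_like_at_def nth_fps_map]]
  by (simp add: nth_fps_bilin free_ext_sum)

lemma fps_inverse_coefficient:
  assumes "group_like_at g n" "fps_map \<epsilon> g = 1" "invertible_within k (fps_nth g n)"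
  shows "fps_nth ((fps_map \<alpha> ^^ k) (fps_bilin \<mu> g (fps_map S g))) n = fps_nth (fps_const one) n"
    and "fps_nth ((fps_map \<alpha> ^^ k) (fps_bilin \<mu> (fps_map S g) g)) n = fps_nth (fps_const one) n"
proof -
  have "\<epsilon> (fps_nth g n) = (if n = 0 then 1 else 0)"
    using arg_cong[OF assms(2), of "\<lambda>f. fps_nth f n"] by simp
  then have "\<eta> (\<epsilon> (fps_nth g n)) = fps_nth (fps_const one) n"
    by (simp add: \<eta>_def)
  then show "fps_nth ((fps_map \<alpha> ^^ k) (fps_bilin \<mu> g (fps_map S g))) n = fps_nth (fps_const one) n"
    and "fps_nth ((fps_map \<alpha> ^^ k) (fps_bilin \<mu> (fps_map S g) g)) n = fps_nth (fps_const one) n"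
    using assms(3) conv_group_like_at[OF linear_id_scale S_linear assms(1)]
      conv_group_like_at[OF S_linear linear_id_scale assms(1)]
    by (simp_all add: invertible_within_def fps_map_pow)
qed

end


section \<open>Quotients of Hom-groups up to congruence\<close>

text \<open>
  The identities hold for all elements before passing to classes; inverses exist only modulo
  \<open>E\<close>. Keeping \<open>E\<close> separate from its restriction
  to \<open>G\<close> splits well-definedness into congruence of the operations and closure of \<open>G\<close>.
\<close>

lemma hom_group_quotient:
  fixes G :: "'g set" and mul :: "'g \<Rightarrow> 'g \<Rightarrow> 'g" and \<alpha> :: "'g \<Rightarrow> 'g"
    and one :: 'g and inv :: "'g \<Rightarrow> 'g" and E :: "'g \<Rightarrow> 'g \<Rightarrow> bool"
  defines "R \<equiv> {(g, h). g \<in> G \<and> h \<in> G \<and> E g h}"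
  assumes E: "equivp E"
    and mul_cong: "\<And>g g' h h'. E g g' \<Longrightarrow> E h h' \<Longrightarrow> E (mul g h) (mul g' h')"
    and twist_cong: "\<And>g g'. E g g' \<Longrightarrow> E (\<alpha> g) (\<alpha> g')"
    and inv_cong: "\<And>g g'. E g g' \<Longrightarrow> E (inv g) (inv g')"
    and one_closed: "one \<in> G"
    and mul_closed: "\<And>g h. g \<in> G \<Longrightarrow> h \<in> G \<Longrightarrow> mul g h \<in> G"
    and inv_closed: "\<And>g. g \<in> G \<Longrightarrow> inv g \<in> G"
    and twist_mul: "\<And>g h. \<alpha> (mul g h) = mul (\<alpha> g) (\<alpha> h)"
    and hom_assoc: "\<And>g h l. mul (\<alpha> g) (mul h l) = mul (mul g h) (\<alpha> l)"
    and mul_one: "\<And>g. mul g one = \<alpha> g"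
    and one_mul: "\<And>g. mul one g = \<alpha> g"
    and twist_one: "\<alpha> one = one"
    and hom_inverse: "\<And>g. g \<in> G \<Longrightarrow>
      \<exists>k. E ((\<alpha> ^^ k) (mul g (inv g))) one \<and> E ((\<alpha> ^^ k) (mul (inv g) g)) one"
    and inv_mul: "\<And>g h. inv (mul g h) = mul (inv h) (inv g)"
    and inv_twist: "\<And>g. inv (\<alpha> g) = \<alpha> (inv g)"
    and inv_one: "inv one = one"
  shows "hom_group (G // R) (quot2 R mul) (quot1 R \<alpha>) (R `` {one}) (quot1 R inv)"
proof -
  have R: "equiv G R"
    using E unfolding R_def
    by (intro equivI refl_onI symI transI) (auto dest: equivp_reflp equivp_symp equivp_transp)
  have twist_closed: "\<alpha> g \<in> G" if "g \<in> G" for g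
    using mul_closed[OF that one_closed] by (simp add: mul_one)
  have class_eq: "R `` {g} = R `` {h}" if "g \<in> G" "h \<in> G" "E g h" for g h
    using equiv_class_eq[OF R] that by (simp add: R_def)
  have q1: "quot1 R f (R `` {g}) = R `` {f g}"
    if "g \<in> G" "\<And>g. g \<in> G \<Longrightarrow> f g \<in> G" "\<And>g h. E g h \<Longrightarrow> E (f g) (f h)" for f g
    unfolding quot1_def
  proof (rule UN_equiv_class[OF R congruentI that(1)])
    show "R `` {f x} = R `` {f y}" if "(x, y) \<in> R" for x y
      using that class_eq[OF \<open>\<And>g. g \<in> G \<Longrightarrow> f g \<in> G\<close> \<open>\<And>g. g \<in> G \<Longrightarrow> f g \<in> G\<close>
          \<open>\<And>g h. E g h \<Longrightarrow> E (f g) (f h)\<close>] by (auto simp: R_def)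
  qed
  have twist: "quot1 R \<alpha> (R `` {g}) = R `` {\<alpha> g}" if "g \<in> G" for g
    using that by (rule q1) (auto intro: twist_closed twist_cong)
  have inv: "quot1 R inv (R `` {g}) = R `` {inv g}" if "g \<in> G" for g
    using that by (rule q1) (auto intro: inv_closed inv_cong)
  have mul: "quot2 R mul (R `` {g}) (R `` {h}) = R `` {mul g h}" if "g \<in> G" "h \<in> G" for g h
    unfolding quot2_def
  proof (rule UN_equiv_class2[OF R R congruent2I' that])
    show "R `` {mul x y} = R `` {mul x' y'}" if "(x, x') \<in> R" "(y, y') \<in> R" for x x' y y'
      using that class_eq[OF mul_closed mul_closed mul_cong] by (auto simp: R_def)
  qed
  have twist_pow: "(\<alpha> ^^ k) g \<in> G \<and> (quot1 R \<alpha> ^^ k) (R `` {g}) = R `` {(\<alpha> ^^ k) g}"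
    if "g \<in> G" for g k
    using that by (induction k) (auto simp: twist twist_closed)
  note ops = twist inv mul one_closed mul_closed twist_closed inv_closed
  note repr = quotientE[where A = G and r = R]
  show ?thesis
  proof
    show "\<exists>k. (quot1 R \<alpha> ^^ k) (quot2 R mul X (quot1 R inv X)) = R `` {one} \<and>
        (quot1 R \<alpha> ^^ k) (quot2 R mul (quot1 R inv X) X) = R `` {one}" if "X \<in> G // R" for X
    proof -
      from that obtain g where X: "X = R `` {g}" and g: "g \<in> G" by (rule quotientE)
      from hom_inverse[OF g] obtain k where
        "E ((\<alpha> ^^ k) (mul g (inv g))) one" "E ((\<alpha> ^^ k) (mul (inv g) g)) one" by blast
      then show ?thesis
        using g by (intro exI[of _ k]) (simp add: X ops twist_pow class_eq)
    qed
  qed (auto elim!: repr intro!: quotientI simp: ops twist_mul hom_assoc mul_one one_mul twist_one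
      inv_mul inv_twist inv_one)
qed


section \<open>The four Hom-groups\<close>

context hom_hopf_algebra
begin

lemma fps_S_mul:
  "fps_map S (fps_bilin \<mu> g h) = fps_bilin \<mu> (fps_map S h) (fps_map S g)"
proof (rule fps_ext)
  fix n
  show "fps_nth (fps_map S (fps_bilin \<mu> g h)) n
      = fps_nth (fps_bilin \<mu> (fps_map S h) (fps_map S g)) n"
    using sum_atLeast0_reflect[of "\<lambda>i j. \<mu> (S (fps_nth h j)) (S (fps_nth g i))" n]
    by (simp add: nth_fps_bilin module_hom.sum[OF S_linear[THEN module_hom_linearI]] S_mu)
qed

lemma S_zero: "S 0 = 0"
  by (rule module_hom.zero[OF S_linear[THEN module_hom_linearI]])

lemma fps_S_one: "fps_map S (fps_const one) = fps_const one"
  by (simp add: fps_map_const S_zero S_one)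

lemma fps_S_alpha: "fps_map S (fps_map \<alpha> g) = fps_map \<alpha> (fps_map S g)"
  by (simp add: fps_eq_iff S_alpha)

lemma fps_eps_mul: "fps_map \<epsilon> (fps_bilin \<mu> g h) = fps_map \<epsilon> g * fps_map \<epsilon> h"
  by (simp add: fps_eq_iff nth_fps_bilin fps_mult_nth eps_mu
      module_hom.sum[OF eps_linear[THEN module_hom_linearI]])

lemma fps_eps_S: "fps_map \<epsilon> (fps_map S g) = fps_map \<epsilon> g"
  by (simp add: fps_eq_iff eps_S)

lemma fps_eps_one: "fps_map \<epsilon> (fps_const one) = 1"
  by (simp add: fps_map_const eps_one module_hom.zero[OF eps_linear[THEN module_hom_linearI]])

lemmas fps_hom_laws = fps_alpha_mul fps_hom_assoc fps_mul_one fps_one_mul fps_alpha_one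
  fps_S_mul fps_S_alpha fps_S_one

definition invertible_within_fps :: "nat \<Rightarrow> 'a fps \<Rightarrow> bool" where
  "invertible_within_fps k g \<longleftrightarrow> (\<forall>n. invertible_within k (fps_nth g n))"

lemma invertible_within_fps_mono:
  "invertible_within_fps k g \<Longrightarrow> k \<le> l \<Longrightarrow> invertible_within_fps l g"
  by (auto simp: invertible_within_fps_def intro: invertible_within_mono)

lemma invertible_within_fps_mul:
  "invertible_within_fps k g \<Longrightarrow> invertible_within_fps l h \<Longrightarrow>
    invertible_within_fps (Suc (max k l)) (fps_bilin \<mu> g h)"
  by (auto simp: invertible_within_fps_def nth_fps_bilin
      intro!: invertible_within_sum invertible_within_mu intro: invertible_within_mono)

lemma invertible_within_fps_S:
  "invertible_within_fps k g \<Longrightarrow> invertible_within_fps k (fps_map S g)"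
  by (simp add: invertible_within_fps_def invertible_within_S)

lemma invertible_within_fps_one: "invertible_within_fps k (fps_const one)"
  by (simp add: invertible_within_fps_def invertible_within_one invertible_within_zero)

lemma bounded_fps_iff: "g \<in> bounded_fps \<longleftrightarrow> (\<exists>k. invertible_within_fps k g)"
  by (simp add: bounded_fps_def inv_index_le_iff invertible_within_fps_def)

lemma formal_group_likes_iff:
  "g \<in> formal_group_likes \<longleftrightarrow>
    (\<exists>k. invertible_within_fps k g) \<and> (\<forall>n. group_like_at g n) \<and> fps_map \<epsilon> g = 1"
  by (simp add: formal_group_likes_def bounded_fps_iff group_like_at_def)

lemma p_order_group_likes_iff:
  "g \<in> p_order_group_likes p \<longleftrightarrow>
    g \<in> fps_polys \<and> (\<forall>n\<le>p. group_like_at g n) \<and> fps_map \<epsilon> g = 1"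
  by (simp add: p_order_group_likes_def group_like_at_def)

lemma polys_invertible_within_fps: "g \<in> fps_polys \<Longrightarrow> \<exists>k. invertible_within_fps k g"
  using inv_index_fps_le_iff[of g "inv_index_fps g"] by (auto simp: invertible_within_fps_def)

lemma formal_sequences_iff:
  "g \<in> formal_sequences \<longleftrightarrow>
    (\<forall>p. g p \<in> fps_polys) \<and> (\<forall>p\<ge>1. g p \<in> p_order_group_likes p) \<and>
    (\<forall>p. fps_cong p (g (Suc p)) (fps_map \<alpha> (g p))) \<and>
    (\<exists>k. \<forall>p. invertible_within_fps k (g p))"
proof (cases "\<forall>p. g p \<in> fps_polys")
  case True
  then show ?thesis
    by (simp add: formal_sequences_def inv_index_fps_le_iff invertible_within_fps_def)
qed (auto simp: formal_sequences_def)

theorem group_likes_hom_group: "hom_group group_likes \<mu> \<alpha> one S"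
proof -
  have one: "one \<in> group_likes"
    by (simp add: group_likes_def Delta_one eps_one)
  have mul: "\<mu> g h \<in> group_likes" if "g \<in> group_likes" "h \<in> group_likes" for g h
    using tensor_eq2_trans[OF Delta_mu tensor_mul_cong[of "\<Delta> g" "tens g g" "\<Delta> h" "tens h h"]] that
    by (simp add: group_likes_def tensor_mul_tens eps_mu)
  have inv: "S g \<in> group_likes" if "g \<in> group_likes" for g
    using tensor_eq2_trans[OF S_Delta tensor_map_flip_cong[OF S_linear S_linear, of "\<Delta> g" "tens g g"]]
      that
    by (simp add: group_likes_def tensor_map_flip eps_S)
  show ?thesis
  proof
    show "\<exists>k. (\<alpha> ^^ k) (\<mu> g (S g)) = one \<and> (\<alpha> ^^ k) (\<mu> (S g) g) = one" if "g \<in> group_likes" for g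
      using that antipode[of g]
        conv_cong[OF S_linear linear_id_scale, of g "tens g g"]
        conv_cong[OF linear_id_scale S_linear, of g "tens g g"]
      by (auto simp: group_likes_def \<eta>_def)
    show "\<alpha> g \<in> group_likes" if "g \<in> group_likes" for g
      using mul[OF that one] by (simp add: mu_one)
  qed (simp_all add: one mul inv alpha_mu hom_assoc mu_one one_mu alpha_one S_mu S_alpha S_one)
qed

theorem formal_group_likes_hom_group:
  "hom_group formal_group_likes (fps_bilin \<mu>) (fps_map \<alpha>) (fps_const one) (fps_map S)"
proof -
  have one: "fps_const one \<in> formal_group_likes"
    using invertible_within_fps_one
    by (auto simp: formal_group_likes_iff group_like_at_one fps_eps_one)
  have mul: "fps_bilin \<mu> g h \<in> formal_group_likes"
    if "g \<in> formal_group_likes" "h \<in> formal_group_likes" for g h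
    using that invertible_within_fps_mul[of _ g _ h]
    by (auto simp: formal_group_likes_iff group_like_at_mul fps_eps_mul)
  have inv: "fps_map S g \<in> formal_group_likes" if "g \<in> formal_group_likes" for g
    using that invertible_within_fps_S[of _ g]
    by (auto simp: formal_group_likes_iff group_like_at_S fps_eps_S)
  show ?thesis
  proof
    show "\<exists>k. (fps_map \<alpha> ^^ k) (fps_bilin \<mu> g (fps_map S g)) = fps_const one \<and>
        (fps_map \<alpha> ^^ k) (fps_bilin \<mu> (fps_map S g) g) = fps_const one"
      if "g \<in> formal_group_likes" for g
      using that fps_inverse_coefficient[of g]
      unfolding formal_group_likes_iff invertible_within_fps_def fps_eq_iff[of _ "fps_const one"]
      by blast
    show "fps_map \<alpha> g \<in> formal_group_likes" if "g \<in> formal_group_likes" for g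
      using mul[OF that one] by (simp add: fps_mul_one)
  qed (simp_all add: one mul inv fps_hom_laws)
qed

lemma p_order_one: "fps_const one \<in> p_order_group_likes p"
  by (simp add: p_order_group_likes_iff fps_const_polys group_like_at_one fps_eps_one)

lemma p_order_mul:
  "g \<in> p_order_group_likes p \<Longrightarrow> h \<in> p_order_group_likes p \<Longrightarrow>
    fps_bilin \<mu> g h \<in> p_order_group_likes p"
  by (auto simp: p_order_group_likes_iff fps_mul_polys fps_eps_mul intro!: group_like_at_mul)

lemma p_order_S: "g \<in> p_order_group_likes p \<Longrightarrow> fps_map S g \<in> p_order_group_likes p"
  by (simp add: p_order_group_likes_iff fps_map_polys S_zero group_like_at_S fps_eps_S)

lemma p_order_inverse:
  assumes "g \<in> p_order_group_likes p" "invertible_within_fps k g"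
  shows "fps_cong p ((fps_map \<alpha> ^^ k) (fps_bilin \<mu> g (fps_map S g))) (fps_const one)"
    and "fps_cong p ((fps_map \<alpha> ^^ k) (fps_bilin \<mu> (fps_map S g) g)) (fps_const one)"
  using assms fps_inverse_coefficient[of g _ k]
  by (simp_all add: p_order_group_likes_iff fps_cong_def invertible_within_fps_def)

theorem p_order_group_likes_hom_group:
  "hom_group (p_order_group_likes p // p_order_rel p) (quot2 (p_order_rel p) (fps_bilin \<mu>))
    (quot1 (p_order_rel p) (fps_map \<alpha>)) (p_order_rel p `` {fps_const one})
    (quot1 (p_order_rel p) (fps_map S))"
  unfolding p_order_rel_def
proof (rule hom_group_quotient)
  fix g assume g: "g \<in> p_order_group_likes p"
  then obtain k where "invertible_within_fps k g"
    using polys_invertible_within_fps by (auto simp: p_order_group_likes_iff)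
  with p_order_inverse[OF g]
  show "\<exists>k. fps_cong p ((fps_map \<alpha> ^^ k) (fps_bilin \<mu> g (fps_map S g))) (fps_const one) \<and>
      fps_cong p ((fps_map \<alpha> ^^ k) (fps_bilin \<mu> (fps_map S g) g)) (fps_const one)"
    by blast
qed (simp_all add: equivp_fps_cong fps_cong_bilin fps_cong_map p_order_one p_order_mul p_order_S
    fps_hom_laws)

text \<open>
  The exponent is the same for all \<open>p\<close>. The successor is needed at \<open>p = 0\<close> only, where
  \<open>g\<^sub>0\<close> is replaced by \<open>\<alpha>(g\<^sub>0)\<close>, which agrees to order \<open>0\<close> with the group-like
  \<open>g\<^sub>1\<close>.
\<close>

lemma formal_sequence_inverse:
  assumes g: "g \<in> formal_sequences" and k: "\<And>p. invertible_within_fps k (g p)"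
  shows "fps_cong p ((fps_map \<alpha> ^^ Suc k) (fps_bilin \<mu> (g p) (fps_map S (g p)))) (fps_const one) \<and>
    fps_cong p ((fps_map \<alpha> ^^ Suc k) (fps_bilin \<mu> (fps_map S (g p)) (g p))) (fps_const one)"
proof (cases "p = 0")
  case False
  then have "g p \<in> p_order_group_likes p"
    using g by (simp add: formal_sequences_iff)
  from p_order_inverse[OF this invertible_within_fps_mono[OF k]] show ?thesis by (simp del: funpow.simps)
next
  case True
  let ?h = "g (Suc 0)"
  have h: "?h \<in> p_order_group_likes (Suc 0)" and "fps_cong 0 ?h (fps_map \<alpha> (g 0))"
    using g by (auto simp: formal_sequences_iff)
  then have cong: "fps_cong 0 (fps_map \<alpha> (g 0)) ?h"
    by (simp add: fps_cong_def)
  have inv: "fps_cong 0 ((fps_map \<alpha> ^^ k) (fps_bilin \<mu> ?h (fps_map S ?h))) (fps_const one)"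
    "fps_cong 0 ((fps_map \<alpha> ^^ k) (fps_bilin \<mu> (fps_map S ?h) ?h)) (fps_const one)"
    using p_order_inverse[OF h k[of "Suc 0"]] by (simp_all add: fps_cong_def)
  have "fps_cong 0 ((fps_map \<alpha> ^^ Suc k) (fps_bilin \<mu> (g 0) (fps_map S (g 0))))
      ((fps_map \<alpha> ^^ k) (fps_bilin \<mu> ?h (fps_map S ?h)))"
    "fps_cong 0 ((fps_map \<alpha> ^^ Suc k) (fps_bilin \<mu> (fps_map S (g 0)) (g 0)))
      ((fps_map \<alpha> ^^ k) (fps_bilin \<mu> (fps_map S ?h) ?h))"
    unfolding funpow_Suc_right comp_apply fps_alpha_mul fps_S_alpha[symmetric] fps_map_pow
    by (intro fps_cong_map fps_cong_bilin cong)+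
  with inv show ?thesis
    unfolding True by (auto intro: equivp_transp[OF equivp_fps_cong])
qed

theorem formal_sequences_hom_group:
  "hom_group (formal_sequences // formal_sequence_rel)
    (quot2 formal_sequence_rel (\<lambda>g h p. fps_bilin \<mu> (g p) (h p)))
    (quot1 formal_sequence_rel (\<lambda>g p. fps_map \<alpha> (g p)))
    (formal_sequence_rel `` {\<lambda>p. fps_const one})
    (quot1 formal_sequence_rel (\<lambda>g p. fps_map S (g p)))"
  unfolding formal_sequence_rel_def
proof (rule hom_group_quotient)
  show "equivp (\<lambda>g h. \<forall>p. fps_cong p (g p) (h p :: 'a fps))"
    by (rule equivpI) (auto simp: reflp_def symp_def transp_def fps_cong_def)
  show "(\<lambda>p. fps_const one) \<in> formal_sequences"
    using invertible_within_fps_one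
    by (auto simp: formal_sequences_iff fps_const_polys p_order_one fps_alpha_one
        equivp_reflp[OF equivp_fps_cong])
  show "(\<lambda>p. fps_map S (g p)) \<in> formal_sequences" if "g \<in> formal_sequences" for g
  proof -
    from that obtain k where "\<And>p. invertible_within_fps k (g p)"
      by (auto simp: formal_sequences_iff)
    then have "invertible_within_fps k (fps_map S (g p))" for p
      by (rule invertible_within_fps_S)
    then show ?thesis
      using that
      by (auto simp: formal_sequences_iff fps_map_polys S_zero p_order_S fps_cong_map
          fps_S_alpha[symmetric])
  qed
  show "(\<lambda>p. fps_bilin \<mu> (g p) (h p)) \<in> formal_sequences"
    if "g \<in> formal_sequences" "h \<in> formal_sequences" for g h
  proof -
    from that obtain k l
      where "\<forall>p. invertible_within_fps k (g p)" "\<forall>p. invertible_within_fps l (h p)"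
      unfolding formal_sequences_iff by blast
    then have "invertible_within_fps (Suc (max k l)) (fps_bilin \<mu> (g p) (h p))" for p
      by (simp add: invertible_within_fps_mul)
    then show ?thesis
      using that
      by (auto simp: formal_sequences_iff fps_mul_polys p_order_mul fps_cong_bilin fps_alpha_mul)
  qed
  fix g assume g: "g \<in> formal_sequences"
  then obtain k where k: "\<And>p. invertible_within_fps k (g p)"
    by (auto simp: formal_sequences_iff)
  have pow: "((\<lambda>g p. fps_map \<alpha> (g p)) ^^ m) f = (\<lambda>p. (fps_map \<alpha> ^^ m) (f p))"
    for m and f :: "nat \<Rightarrow> 'a fps"
    by (induction m) simp_all
  show "\<exists>k. (\<forall>p. fps_cong p (((\<lambda>g p. fps_map \<alpha> (g p)) ^^ k)
        (\<lambda>p. fps_bilin \<mu> (g p) (fps_map S (g p))) p) (fps_const one)) \<and>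
      (\<forall>p. fps_cong p (((\<lambda>g p. fps_map \<alpha> (g p)) ^^ k)
        (\<lambda>p. fps_bilin \<mu> (fps_map S (g p)) (g p)) p) (fps_const one))"
    unfolding pow using formal_sequence_inverse[OF g k] by blast
qed (simp_all add: fps_cong_bilin fps_cong_map fps_hom_laws)

end

theorem proposition3p3:
  fixes scale :: "'k::field \<Rightarrow> 'a::ab_group_add \<Rightarrow> 'a"
    and \<mu> :: "'a \<Rightarrow> 'a \<Rightarrow> 'a" and \<alpha> :: "'a \<Rightarrow> 'a" and one :: 'a
    and \<Delta> :: "'a \<Rightarrow> ('a \<times> 'a \<Rightarrow>\<^sub>0 'k)" and \<beta> :: "'a \<Rightarrow> 'a" and \<epsilon> :: "'a \<Rightarrow> 'k"
    and S :: "'a \<Rightarrow> 'a"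
  assumes "hom_hopf_algebra scale \<mu> \<alpha> one \<Delta> \<beta> \<epsilon> S"
  shows "hom_group (hom_hopf_algebra.group_likes scale \<Delta> \<epsilon>) \<mu> \<alpha> one S
    \<and> hom_group (hom_hopf_algebra.formal_group_likes scale \<mu> \<alpha> one \<Delta> \<epsilon> S)
        (fps_bilin \<mu>) (fps_map \<alpha>) (fps_const one) (fps_map S)
    \<and> (\<forall>p. let G = hom_hopf_algebra.p_order_group_likes scale \<Delta> \<epsilon> p;
               R = hom_hopf_algebra.p_order_rel scale \<Delta> \<epsilon> p
           in hom_group (G // R) (quot2 R (fps_bilin \<mu>)) (quot1 R (fps_map \<alpha>))
                (R `` {fps_const one}) (quot1 R (fps_map S)))
    \<and> (let G = hom_hopf_algebra.formal_sequences scale \<mu> \<alpha> one \<Delta> \<epsilon> S;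
           R = hom_hopf_algebra.formal_sequence_rel scale \<mu> \<alpha> one \<Delta> \<epsilon> S
       in hom_group (G // R)
            (quot2 R (\<lambda>g h p. fps_bilin \<mu> (g p) (h p))) (quot1 R (\<lambda>g p. fps_map \<alpha> (g p)))
            (R `` {\<lambda>p. fps_const one}) (quot1 R (\<lambda>g p. fps_map S (g p))))"
proof -
  interpret hom_hopf_algebra scale \<mu> \<alpha> one \<Delta> \<beta> \<epsilon> S by fact
  show ?thesis
    unfolding Let_def
    by (intro conjI allI group_likes_hom_group formal_group_likes_hom_group
        p_order_group_likes_hom_group formal_sequences_hom_group)
qed

end
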